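(* For each $a\in\mathbb{R}$ and $c\in\mathbb{C}$ define $$N_{a,c}=\Bigl\{(z_1,z_2,z_3)\in\mathbb{C}^3:\ |z_1|^2-a=|z_2|^2+a=|z_3-c|^2+|a|,\ \operatorname{Im}\bigl(z_1z_2(z_3-c)\bigr)=0,\ \operatorname{Re}\bigl(z_1z_2(z_3-c)\bigr)\ge 0\Bigr\}.$$ Then $N_{a,c}$ is a nonsingular special Lagrangian 3-fold diffeomorphic to $\mathcal{S}^1\times\mathbb{R}^2$ if $a\neq 0$, and $N_{0,c}$ is a special Lagrangian $T^2$-cone singular only at $(0,0,c)$. Define $F:\mathbb{C}^3\to\mathbb{R}\times\mathbb{C}$ by $F(z_1,z_2,z_3)=(a,b)$, where $2a=|z_1|^2-|z_2|^2$ and $$b=\begin{cases} z_3, & a=z_1=z_2=0,\\ z_3-\bar z_1\bar z_2/|z_1|, & a\ge 0,\ z_1\neq 0,\\ z_3-\bar z_1\bar z_2/|z_2|, & a<0.\end{cases}$$ Then $F^{-1}(a,c)=N_{a,c}$ for all $(a,c)\in\mathbb{R}\times\mathbb{C}$, and $F$ is a well-defined, continuous, piecewise-smooth special Lagrangian fibration of $\mathbb{C}^3$ which is not smooth on the hypersurface $\{|z_1|=|z_2|\}$.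
   Context: On $\mathbb{C}^3$ with coordinates $(z_1,z_2,z_3)$ let $\omega'=\frac{i}{2}\sum_{j=1}^3 dz_j\wedge d\bar z_j$ and $\Omega'=dz_1\wedge dz_2\wedge dz_3$. A real 3-dimensional submanifold $L$ is special Lagrangian (SL) if $\omega'|_L\equiv 0$ and $\operatorname{Im}\Omega'|_L\equiv 0$; a singular SL 3-fold is a closed subset which is an SL submanifold away from a set of singular points. An SL $T^2$-cone with vertex $p$ is a singular SL 3-fold invariant under dilations $p+t(\mathbf{z}-p)$, $t>0$, nonsingular away from $p$, whose intersection with the unit sphere about $p$ is a 2-torus. A special Lagrangian fibration of an open set $V\subseteq\mathbb{C}^3$ is a continuous surjective map from $V$ to a topological space all of whose fibres are (possibly singular) SL 3-folds. *)

theory Defs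
  imports "HOL-Analysis.Analysis"
begin

fun Ck_on :: "nat \<Rightarrow> 'a::euclidean_space set \<Rightarrow> ('a \<Rightarrow> 'b::euclidean_space) \<Rightarrow> bool" where
  "Ck_on 0 U f = continuous_on U f"
| "Ck_on (Suc k) U f =
     (f differentiable_on U \<and> (\<forall>v. Ck_on k U (\<lambda>x. frechet_derivative f (at x) v)))"

definition smooth_on :: "'a::euclidean_space set \<Rightarrow> ('a \<Rightarrow> 'b::euclidean_space) \<Rightarrow> bool" where
  "smooth_on U f \<longleftrightarrow> open U \<and> (\<forall>k. Ck_on k U f)"

definition smooth_at :: "('a::euclidean_space \<Rightarrow> 'b::euclidean_space) \<Rightarrow> 'a \<Rightarrow> bool" where
  "smooth_at f z \<longleftrightarrow> (\<exists>U. open U \<and> z \<in> U \<and> smooth_on U f)"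

definition smooth_map_on :: "'a::euclidean_space set \<Rightarrow> ('a \<Rightarrow> 'b::euclidean_space) \<Rightarrow> bool" where
  "smooth_map_on A f \<longleftrightarrow>
     (\<forall>x\<in>A. \<exists>U g. x \<in> U \<and> smooth_on U g \<and> (\<forall>y\<in>A \<inter> U. g y = f y))"

definition diffeomorphic ::
  "'a::euclidean_space set \<Rightarrow> 'b::euclidean_space set \<Rightarrow> bool" where
  "diffeomorphic A B \<longleftrightarrow>
     (\<exists>f g. homeomorphism A B f g \<and> smooth_map_on A f \<and> smooth_map_on B g)"

text \<open>The Kaehler form and holomorphic volume form of C^3, evaluated on real tangent vectors.
  omega' = i/2 sum dz_j wedge dzbar_j gives omega'(u,v) = sum_j Im(conj u_j * v_j);
  Omega' = dz_1 wedge dz_2 wedge dz_3 gives Omega'(u,v,w) = det of the matrix with rows u,v,w.\<close>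

definition omega_C3 :: "complex^3 \<Rightarrow> complex^3 \<Rightarrow> real" where
  "omega_C3 u v = (\<Sum>j\<in>UNIV. Im (cnj (u $ j) * v $ j))"

definition Omega_C3 :: "complex^3 \<Rightarrow> complex^3 \<Rightarrow> complex^3 \<Rightarrow> complex" where
  "Omega_C3 u v w = det (vector [u, v, w] :: complex^3^3)"

definition SL_submanifold :: "(complex^3) set \<Rightarrow> bool" where
  "SL_submanifold L \<longleftrightarrow>
     (\<forall>p\<in>L. \<exists>U V \<phi> \<psi>. open U \<and> p \<in> U \<and> open (V :: (real^3) set) \<and>
        smooth_on V \<phi> \<and> homeomorphism V (L \<inter> U) \<phi> \<psi> \<and>
        (\<forall>x\<in>V. inj (frechet_derivative \<phi> (at x)) \<and>
           (\<forall>a b. omega_C3 (frechet_derivative \<phi> (at x) a) (frechet_derivative \<phi> (at x) b) = 0) \<and>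
           (\<forall>a b c. Im (Omega_C3 (frechet_derivative \<phi> (at x) a) (frechet_derivative \<phi> (at x) b)
                                (frechet_derivative \<phi> (at x) c)) = 0)))"

definition singular_points :: "(complex^3) set \<Rightarrow> (complex^3) set" where
  "singular_points S = {p \<in> S. \<not> (\<exists>U. open U \<and> p \<in> U \<and> SL_submanifold (S \<inter> U))}"

definition singular_SL3 :: "(complex^3) set \<Rightarrow> bool" where
  "singular_SL3 S \<longleftrightarrow> closed S \<and> SL_submanifold (S - singular_points S)"

definition nonsingular_SL3 :: "(complex^3) set \<Rightarrow> bool" where
  "nonsingular_SL3 S \<longleftrightarrow> closed S \<and> SL_submanifold S"

definition torus2 :: "(complex \<times> complex) set" where
  "torus2 = sphere 0 1 \<times> sphere 0 1"

definition SL_T2_cone :: "complex^3 \<Rightarrow> (complex^3) set \<Rightarrow> bool" where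
  "SL_T2_cone p C \<longleftrightarrow>
     singular_SL3 C \<and>
     (\<forall>t>0. \<forall>z\<in>C. p + t *\<^sub>R (z - p) \<in> C) \<and>
     singular_points C \<subseteq> {p} \<and>
     diffeomorphic (C \<inter> sphere p 1) torus2"

definition SL_fibration ::
  "(complex^3) set \<Rightarrow> ((complex^3) \<Rightarrow> 'b::topological_space) \<Rightarrow> 'b set \<Rightarrow> bool" where
  "SL_fibration V F X \<longleftrightarrow>
     open V \<and> continuous_on V F \<and> F ` V = X \<and>
     (\<forall>y\<in>X. singular_SL3 {z \<in> V. F z = y})"

definition N_ac :: "real \<Rightarrow> complex \<Rightarrow> (complex^3) set" where
  "N_ac a c = {z. (cmod (z$1))\<^sup>2 - a = (cmod (z$2))\<^sup>2 + a \<and>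
                   (cmod (z$2))\<^sup>2 + a = (cmod (z$3 - c))\<^sup>2 + \<bar>a\<bar> \<and>
                   Im (z$1 * z$2 * (z$3 - c)) = 0 \<and> Re (z$1 * z$2 * (z$3 - c)) \<ge> 0}"

definition F_fib :: "complex^3 \<Rightarrow> real \<times> complex" where
  "F_fib z = (let a = ((cmod (z$1))\<^sup>2 - (cmod (z$2))\<^sup>2) / 2 in
     (a, if a = 0 \<and> z$1 = 0 \<and> z$2 = 0 then z$3
         else if a \<ge> 0 \<and> z$1 \<noteq> 0 then z$3 - cnj (z$1) * cnj (z$2) / complex_of_real (cmod (z$1))
         else z$3 - cnj (z$1) * cnj (z$2) / complex_of_real (cmod (z$2))))"

end

theory Submission
  imports Defs
begin

text \<open>
  With \<open>m = max |z1| |z2|\<close> the three cases of \<open>F\<close> merge into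
  \<open>F z = ((|z1|^2 - |z2|^2)/2, z3 - cnj (z1 z2)/m)\<close>, using \<open>0/0 = 0\<close>; continuity and the description of
  the fibres follow. For \<open>a \<ge> 0\<close> the part \<open>z1 \<noteq> 0\<close> of the fibre is parametrised by an angle \<open>\<theta>\<close> and
  \<open>u = z2\<close> through \<open>(e^(i\<theta>) sqrt(|u|^2 + 2a), u, c + e^(-i\<theta>) cnj u)\<close>, on whose tangent vectors both
  \<open>\<omega>'\<close> and \<open>Im \<Omega>'\<close> vanish by direct computation; exchanging \<open>z1\<close> and \<open>z2\<close> reduces \<open>a < 0\<close> to \<open>a > 0\<close>.
  A chart of the cone at its vertex would have all rays of the cone in its Lagrangian tangent space,
  but \<open>\<omega>'\<close> is nonzero on the rays \<open>(1,1,1)\<close> and \<open>(i,i,-1)\<close>. Finally, along \<open>t \<mapsto> ((1+t) z1, z2, z3)\<close> with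
  \<open>|z1| = |z2| \<noteq> 0\<close> the one-sided derivatives of \<open>F\<close> at \<open>t = 0\<close> differ.
\<close>

section \<open>Calculus of smooth maps\<close>

text \<open>On an open set, equal functions have equal derivatives at every point, so the induction
  hypothesis applies to each directional derivative; this is why \<open>f\<close> and
  \<open>g\<close> are generalised.\<close>

lemma Ck_on_cong:
  assumes "open U" "\<And>x. x \<in> U \<Longrightarrow> f x = g x" "Ck_on k U f"
  shows "Ck_on k U g"
  using assms(2,3)
proof (induction k arbitrary: f g)
  case 0
  then show ?case by (auto intro: continuous_on_eq)
next
  case (Suc k)
  have d: "f differentiable at x" if "x \<in> U" for x
    using Suc.prems(2) that assms(1) by (auto simp: differentiable_on_eq_differentiable_at)
  have eq: "frechet_derivative f (at x) = frechet_derivative g (at x)" if "x \<in> U" for x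
    using frechet_derivative_transform_within_open[OF d assms(1)] that Suc.prems(1) by blast
  have "g differentiable_on U"
    using Suc.prems by (auto simp: differentiable_on_def intro: differentiable_transform_within[OF _ zero_less_one])
  moreover have "Ck_on k U (\<lambda>x. frechet_derivative g (at x) v)" for v
    by (rule Suc.IH[of "\<lambda>x. frechet_derivative f (at x) v"]) (use Suc.prems eq in auto)
  ultimately show ?case by simp
qed

text \<open>This rule replaces the chosen \<open>frechet_derivative\<close> by an explicit formula
  \<open>f'\<close>; the inductive smoothness proofs below all go through it.\<close>

lemma Ck_on_SucI:
  assumes "open U" "\<And>x. x \<in> U \<Longrightarrow> (f has_derivative f' x) (at x)" "\<And>v. Ck_on k U (\<lambda>x. f' x v)"
  shows "Ck_on (Suc k) U f"
proof -
  have "Ck_on k U (\<lambda>x. frechet_derivative f (at x) v)" for v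
    by (rule Ck_on_cong[OF assms(1) _ assms(3)[of v]]) (metis assms(2) frechet_derivative_at)
  then show ?thesis
    using assms(1,2) by (auto simp: differentiable_on_eq_differentiable_at differentiable_def)
qed

lemma Ck_on_Suc_has_derivative:
  assumes "Ck_on (Suc k) U f" "open U" "x \<in> U"
  shows "(f has_derivative frechet_derivative f (at x)) (at x)"
  using assms by (auto simp: differentiable_on_eq_differentiable_at frechet_derivative_works)

lemma Ck_on_Suc_imp_Ck_on:
  assumes "Ck_on (Suc k) U f"
  shows "Ck_on k U f"
  using assms
proof (induction k arbitrary: f)
  case 0
  then show ?case by (auto intro: differentiable_imp_continuous_on)
next
  case (Suc k)
  then show ?case by (metis Ck_on.simps(2))
qed

lemma Ck_on_const: "Ck_on k U (\<lambda>x. c)"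
  by (induction k arbitrary: c) (auto simp: differentiable_on_def)

lemma Ck_on_id:
  assumes "open U"
  shows "Ck_on k U (\<lambda>x. x)"
proof (cases k)
  case (Suc k')
  then show ?thesis
    using Ck_on_SucI[OF assms has_derivative_ident] Ck_on_const by blast
qed auto

lemma Ck_on_linear:
  assumes "bounded_linear L" "open U" "Ck_on k U f"
  shows "Ck_on k U (\<lambda>x. L (f x))"
  using assms(3)
proof (induction k arbitrary: f)
  case 0
  then show ?case using bounded_linear.continuous_on[OF assms(1)] by auto
next
  case (Suc k)
  show ?case
  proof (rule Ck_on_SucI[OF assms(2)])
    show "((\<lambda>x. L (f x)) has_derivative (\<lambda>v. L (frechet_derivative f (at x) v))) (at x)" if "x \<in> U" for x
      by (intro bounded_linear.has_derivative[OF assms(1)] Ck_on_Suc_has_derivative[OF Suc.prems assms(2) that])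
  qed (use Suc in auto)
qed

lemma Ck_on_add:
  assumes "open U" "Ck_on k U f" "Ck_on k U g"
  shows "Ck_on k U (\<lambda>x. f x + g x)"
  using assms(2,3)
proof (induction k arbitrary: f g)
  case 0
  then show ?case by (auto intro: continuous_on_add)
next
  case (Suc k)
  show ?case
  proof (rule Ck_on_SucI[OF assms(1)])
    show "((\<lambda>x. f x + g x) has_derivative
        (\<lambda>v. frechet_derivative f (at x) v + frechet_derivative g (at x) v)) (at x)" if "x \<in> U" for x
      by (intro has_derivative_add Ck_on_Suc_has_derivative[OF _ assms(1) that]) fact+
  qed (use Suc in auto)
qed

lemma Ck_on_sum:
  assumes "open U" "finite I" "\<And>i. i \<in> I \<Longrightarrow> Ck_on k U (f i)"
  shows "Ck_on k U (\<lambda>x. \<Sum>i\<in>I. f i x)"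
  using assms(2,3)
  by (induction I rule: finite_induct) (auto intro: Ck_on_const Ck_on_add[OF assms(1)])

text \<open>By the product rule the derivative is a sum of two products of \<open>C^k\<close>
  factors; the underived factor is \<open>C^k\<close> by \<open>Ck_on_Suc_imp_Ck_on\<close>.\<close>

lemma Ck_on_bilinear:
  fixes prod :: "'b::euclidean_space \<Rightarrow> 'c::euclidean_space \<Rightarrow> 'd::euclidean_space"
  assumes "bounded_bilinear prod" "open U" "Ck_on k U f" "Ck_on k U g"
  shows "Ck_on k U (\<lambda>x. prod (f x) (g x))"
  using assms(3,4)
proof (induction k arbitrary: f g)
  case 0
  then show ?case using bounded_bilinear.continuous_on[OF assms(1)] by auto
next
  case (Suc k)
  have "Ck_on k U f" "Ck_on k U g"
    using Suc.prems Ck_on_Suc_imp_Ck_on by blast+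
  show ?case
  proof (rule Ck_on_SucI[OF assms(2)])
    show "((\<lambda>x. prod (f x) (g x)) has_derivative
        (\<lambda>v. prod (f x) (frechet_derivative g (at x) v) + prod (frechet_derivative f (at x) v) (g x))) (at x)"
      if "x \<in> U" for x
      by (intro bounded_bilinear.FDERIV[OF assms(1)] Ck_on_Suc_has_derivative[OF _ assms(2) that]) fact+
    show "Ck_on k U (\<lambda>x. prod (f x) (frechet_derivative g (at x) v) + prod (frechet_derivative f (at x) v) (g x))" for v
      by (intro Ck_on_add[OF assms(2)] Suc.IH) (use Suc.prems \<open>Ck_on k U f\<close> \<open>Ck_on k U g\<close> in auto)
  qed
qed

lemma Ck_on_compose:
  fixes f :: "'a::euclidean_space \<Rightarrow> 'b::euclidean_space" and g :: "'b \<Rightarrow> 'c::euclidean_space"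
  assumes "open U" "open V" "f ` U \<subseteq> V" "Ck_on k U f" "Ck_on k V g"
  shows "Ck_on k U (\<lambda>x. g (f x))"
  using assms(4,5)
proof (induction k arbitrary: g)
  case 0
  then show ?case using continuous_on_compose2 assms(3) by auto
next
  case (Suc k)
  \<comment> \<open>The chain rule expanded over \<open>Basis\<close>: the direction fed to the
    derivative of \<open>g\<close> becomes a constant \<open>i\<close>, so that factor is again a
    fixed function composed with \<open>f\<close>, and the induction hypothesis covers it.\<close>
  let ?D = "\<lambda>x v. \<Sum>i\<in>Basis. (frechet_derivative f (at x) v \<bullet> i) *\<^sub>R frechet_derivative g (at (f x)) i"
  show ?case
  proof (rule Ck_on_SucI[OF assms(1)])
    fix x assume x: "x \<in> U"
    have g: "(g has_derivative frechet_derivative g (at (f x))) (at (f x))"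
      using Ck_on_Suc_has_derivative[OF Suc.prems(2) assms(2)] x assms(3) by blast
    have D: "((\<lambda>x. g (f x)) has_derivative (\<lambda>v. frechet_derivative g (at (f x)) (frechet_derivative f (at x) v))) (at x)"
      by (rule has_derivative_compose[OF Ck_on_Suc_has_derivative[OF Suc.prems(1) assms(1) x] g])
    have rep: "frechet_derivative g (at (f x)) w = (\<Sum>i\<in>Basis. (w \<bullet> i) *\<^sub>R frechet_derivative g (at (f x)) i)" for w
      using has_derivative_linear[OF g]
      by (subst euclidean_representation[of w, symmetric]) (simp only: linear_sum linear_scale)
    show "((\<lambda>x. g (f x)) has_derivative ?D x) (at x)"
      by (rule has_derivative_eq_rhs[OF D], rule ext, rule rep)
  next
    fix v
    show "Ck_on k U (\<lambda>x. ?D x v)"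
    proof (intro Ck_on_sum[OF assms(1)] Ck_on_bilinear[OF bounded_bilinear_scaleR assms(1)])
      fix i :: 'b assume "i \<in> Basis"
      show "Ck_on k U (\<lambda>x. frechet_derivative f (at x) v \<bullet> i)"
        using Suc.prems by (intro Ck_on_linear[OF bounded_linear_inner_left assms(1)]) auto
      show "Ck_on k U (\<lambda>x. frechet_derivative g (at (f x)) i)"
        by (rule Suc.IH[OF Ck_on_Suc_imp_Ck_on[OF Suc.prems(1)]]) (use Suc.prems in auto)
    qed auto
  qed
qed

section \<open>Smoothness of the inverse, the square root and \<open>cis\<close>\<close>

text \<open>The derivative is a polynomial in \<open>inverse x\<close> itself, so the induction
  closes.\<close>

lemma Ck_on_inverse: "Ck_on k {x::real. x \<noteq> 0} inverse"
proof (induction k)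
  case 0
  then show ?case by (auto intro!: continuous_intros)
next
  case (Suc k)
  have o: "open {x::real. x \<noteq> 0}" by (simp add: open_Collect_neq)
  show ?case
  proof (rule Ck_on_SucI[OF o])
    show "(inverse has_derivative (\<lambda>v. v * - (inverse x * inverse x))) (at x)" if "x \<in> {x. x \<noteq> 0}" for x :: real
      by (rule has_derivative_eq_rhs[OF has_derivative_inverse'])
        (use that in \<open>auto simp: algebra_simps\<close>)
    show "Ck_on k {x. x \<noteq> 0} (\<lambda>x. v * - (inverse x * inverse x))" for v :: real
      by (intro Ck_on_bilinear[OF bounded_bilinear_mult o] Ck_on_const Suc
          Ck_on_linear[OF bounded_linear_minus[OF bounded_linear_ident] o])
  qed
qed

lemma Ck_on_sqrt: "Ck_on k {0<..} sqrt"
proof (induction k)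
  case 0
  then show ?case by (auto intro!: continuous_intros)
next
  case (Suc k)
  have o: "open {0::real<..}" by simp
  have inv: "Ck_on k {0::real<..} inverse"
    using Ck_on_compose[OF o _ _ Ck_on_id[OF o] Ck_on_inverse] by (auto simp: open_Collect_neq)
  show ?case
  proof (rule Ck_on_SucI[OF o])
    \<comment> \<open>Writing \<open>1 / (2 sqrt x)\<close> as
      \<open>(1/2) * (inverse x * sqrt x)\<close> expresses the derivative through
      \<open>sqrt\<close> again and the already smooth \<open>inverse\<close>.\<close>
    show "(sqrt has_derivative (\<lambda>v. v * ((1/2) * (inverse x * sqrt x)))) (at x)" if "x \<in> {0<..}" for x
    proof -
      have "inverse (sqrt x) / 2 = (1/2) * (inverse x * sqrt x)"
        using that by (simp add: field_simps)
      moreover have "(sqrt has_derivative (*) (inverse (sqrt x) / 2)) (at x)"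
        using DERIV_real_sqrt[of x] that unfolding has_field_derivative_def by simp
      ultimately show ?thesis
        by (metis (no_types, lifting) has_derivative_eq_rhs ext mult.commute)
    qed
    show "Ck_on k {0<..} (\<lambda>x. v * ((1/2) * (inverse x * sqrt x)))" for v :: real
      by (intro Ck_on_bilinear[OF bounded_bilinear_mult o] Ck_on_const Suc inv)
  qed
qed

lemma has_derivative_cis: "(cis has_derivative (\<lambda>v. v *\<^sub>R (\<i> * cis x))) (at x)"
proof -
  have "((\<lambda>x. complex_of_real (cos x) + \<i> * complex_of_real (sin x)) has_derivative
      (\<lambda>v. complex_of_real (- sin x * v) + \<i> * complex_of_real (cos x * v))) (at x)"
    by (auto intro!: derivative_eq_intros)
  moreover have "cis = (\<lambda>x. complex_of_real (cos x) + \<i> * complex_of_real (sin x))"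
    by (auto simp: complex_eq_iff fun_eq_iff)
  moreover have "(\<lambda>v. v *\<^sub>R (\<i> * cis x)) = (\<lambda>v. complex_of_real (- sin x * v) + \<i> * complex_of_real (cos x * v))"
    by (auto simp: complex_eq_iff fun_eq_iff)
  ultimately show ?thesis by simp
qed

lemma Ck_on_cis: "Ck_on k UNIV cis"
proof (induction k)
  case 0
  then show ?case by (auto intro!: continuous_intros)
next
  case (Suc k)
  show ?case
    by (rule Ck_on_SucI[OF open_UNIV has_derivative_cis])
      (intro Ck_on_bilinear[OF bounded_bilinear_scaleR] Ck_on_bilinear[OF bounded_bilinear_mult]
        Ck_on_const Suc open_UNIV)
qed

section \<open>Closure rules for \<open>smooth_on\<close>\<close>

lemma smooth_on_const: "open U \<Longrightarrow> smooth_on U (\<lambda>x. c)"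
  by (simp add: smooth_on_def Ck_on_const)

lemma smooth_on_id: "open U \<Longrightarrow> smooth_on U (\<lambda>x. x)"
  by (simp add: smooth_on_def Ck_on_id)

lemma smooth_on_linear: "bounded_linear L \<Longrightarrow> smooth_on U f \<Longrightarrow> smooth_on U (\<lambda>x. L (f x))"
  by (simp add: smooth_on_def Ck_on_linear)

lemma smooth_on_add: "smooth_on U f \<Longrightarrow> smooth_on U g \<Longrightarrow> smooth_on U (\<lambda>x. f x + g x)"
  by (simp add: smooth_on_def Ck_on_add)

lemma smooth_on_minus: "smooth_on U f \<Longrightarrow> smooth_on U (\<lambda>x. - f x)"
  by (rule smooth_on_linear[OF bounded_linear_minus[OF bounded_linear_ident]])

lemma smooth_on_diff: "smooth_on U f \<Longrightarrow> smooth_on U g \<Longrightarrow> smooth_on U (\<lambda>x. f x - g x)"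
  using smooth_on_add[OF _ smooth_on_minus, of U f g] by simp

lemma smooth_on_sum:
  "open U \<Longrightarrow> finite I \<Longrightarrow> (\<And>i. i \<in> I \<Longrightarrow> smooth_on U (f i)) \<Longrightarrow> smooth_on U (\<lambda>x. \<Sum>i\<in>I. f i x)"
  by (simp add: smooth_on_def Ck_on_sum)

lemma smooth_on_mult:
  fixes f g :: "'a::euclidean_space \<Rightarrow> 'b::{euclidean_space, real_normed_algebra}"
  shows "smooth_on U f \<Longrightarrow> smooth_on U g \<Longrightarrow> smooth_on U (\<lambda>x. f x * g x)"
  by (simp add: smooth_on_def Ck_on_bilinear[OF bounded_bilinear_mult])

lemma smooth_on_power2:
  fixes f :: "'a::euclidean_space \<Rightarrow> 'b::{euclidean_space, real_normed_algebra_1}"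
  shows "smooth_on U f \<Longrightarrow> smooth_on U (\<lambda>x. (f x)\<^sup>2)"
  by (simp add: power2_eq_square smooth_on_mult)

lemma smooth_on_compose:
  "smooth_on U f \<Longrightarrow> smooth_on V g \<Longrightarrow> f ` U \<subseteq> V \<Longrightarrow> smooth_on U (\<lambda>x. g (f x))"
  unfolding smooth_on_def using Ck_on_compose by blast

lemma smooth_on_inverse:
  fixes f :: "'a::euclidean_space \<Rightarrow> real"
  assumes "smooth_on U f" "\<And>x. x \<in> U \<Longrightarrow> f x \<noteq> 0"
  shows "smooth_on U (\<lambda>x. inverse (f x))"
  by (rule smooth_on_compose[OF assms(1), of "{x. x \<noteq> 0}"])
    (use assms(2) in \<open>auto simp: smooth_on_def Ck_on_inverse open_Collect_neq\<close>)

lemma smooth_on_sqrt: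
  assumes "smooth_on U f" "\<And>x. x \<in> U \<Longrightarrow> f x > 0"
  shows "smooth_on U (\<lambda>x. sqrt (f x))"
  by (rule smooth_on_compose[OF assms(1), of "{0<..}"])
    (use assms(2) in \<open>auto simp: smooth_on_def Ck_on_sqrt\<close>)

lemma smooth_on_cis: "smooth_on U f \<Longrightarrow> smooth_on U (\<lambda>x. cis (f x))"
  by (rule smooth_on_compose[of _ _ UNIV]) (auto simp: smooth_on_def Ck_on_cis)

lemmas smooth_on_Re = smooth_on_linear[OF bounded_linear_Re]
  and smooth_on_Im = smooth_on_linear[OF bounded_linear_Im]
  and smooth_on_cnj = smooth_on_linear[OF bounded_linear_cnj]
  and smooth_on_fst = smooth_on_linear[OF bounded_linear_fst]
  and smooth_on_snd = smooth_on_linear[OF bounded_linear_snd]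
  and smooth_on_vec_nth = smooth_on_linear[OF bounded_linear_vec_nth]

lemma smooth_on_of_real: "smooth_on U f \<Longrightarrow> smooth_on U (\<lambda>x. complex_of_real (f x))"
  by (rule smooth_on_linear[OF bounded_linear_of_real])

lemma smooth_on_cmod_power2: "smooth_on U f \<Longrightarrow> smooth_on U (\<lambda>x. (cmod (f x))\<^sup>2)"
  unfolding cmod_power2 by (intro smooth_on_add smooth_on_power2 smooth_on_Re smooth_on_Im)

text \<open>The modulus is the square root of a polynomial in real and imaginary part that is
  positive where \<open>f\<close> does not vanish.\<close>

lemma smooth_on_cmod:
  assumes "smooth_on U f" "\<And>x. x \<in> U \<Longrightarrow> f x \<noteq> 0"
  shows "smooth_on U (\<lambda>x. cmod (f x))"
proof -
  have "smooth_on U (\<lambda>x. sqrt ((cmod (f x))\<^sup>2))"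
    by (intro smooth_on_sqrt smooth_on_cmod_power2 assms(1)) (use assms(2) in auto)
  then show ?thesis by simp
qed

lemma smooth_on_Pair:
  fixes f :: "'a::euclidean_space \<Rightarrow> 'b::euclidean_space" and g :: "'a \<Rightarrow> 'c::euclidean_space"
  assumes "smooth_on U f" "smooth_on U g"
  shows "smooth_on U (\<lambda>x. (f x, g x))"
proof -
  have "smooth_on U (\<lambda>x. (f x, 0) + (0, g x))"
    by (intro smooth_on_add smooth_on_linear[OF _ assms(1)] smooth_on_linear[OF _ assms(2)]
        bounded_linear_Pair bounded_linear_zero bounded_linear_ident)
  then show ?thesis by simp
qed

lemma smooth_on_Complex:
  assumes "smooth_on U f" "smooth_on U g"
  shows "smooth_on U (\<lambda>x. Complex (f x) (g x))"
proof -
  have "open U" using assms by (simp add: smooth_on_def)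
  then show ?thesis
    unfolding Complex_eq by (intro smooth_on_add smooth_on_mult smooth_on_of_real smooth_on_const assms)
qed

lemma bounded_linear_axis: "bounded_linear (axis i :: 'b::euclidean_space \<Rightarrow> 'b^'n)"
  by (rule linear_conv_bounded_linear[THEN iffD1], rule linearI) (simp_all add: axis_def vec_eq_iff)

lemma sum_axis: "(\<Sum>i\<in>UNIV. axis i (v $ i)) = (v :: 'b::euclidean_space^'n)"
  by (simp add: vec_eq_iff axis_def if_distrib cong: if_cong)

text \<open>A vector is the sum of its components embedded by the linear maps
  \<open>axis i\<close>.\<close>

lemma smooth_on_vec:
  fixes f :: "'a::euclidean_space \<Rightarrow> 'b::euclidean_space ^ 'n"
  assumes "open U" "\<And>i. smooth_on U (\<lambda>x. f x $ i)"
  shows "smooth_on U f"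
proof -
  have "smooth_on U (\<lambda>x. \<Sum>i\<in>UNIV. axis i (f x $ i))"
    by (intro smooth_on_sum[OF assms(1) finite] smooth_on_linear[OF bounded_linear_axis assms(2)])
  then show ?thesis by (simp add: sum_axis)
qed

lemma smooth_on_vector3:
  assumes "smooth_on U f" "smooth_on U g" "smooth_on U h"
  shows "smooth_on U (\<lambda>x. vector [f x, g x, h x] :: 'b::euclidean_space^3)"
proof (rule smooth_on_vec)
  show "open U" using assms by (simp add: smooth_on_def)
  show "smooth_on U (\<lambda>x. (vector [f x, g x, h x] :: 'b^3) $ i)" for i
    using exhaust_3[of i] assms by auto
qed

lemma smooth_on_vector2:
  assumes "smooth_on U f" "smooth_on U g"
  shows "smooth_on U (\<lambda>x. vector [f x, g x] :: 'b::euclidean_space^2)"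
proof (rule smooth_on_vec)
  show "open U" using assms by (simp add: smooth_on_def)
  show "smooth_on U (\<lambda>x. (vector [f x, g x] :: 'b^2) $ i)" for i
    using exhaust_2[of i] assms by auto
qed

lemmas smooth_on_intros =
  smooth_on_const smooth_on_id smooth_on_add smooth_on_minus smooth_on_diff smooth_on_mult
  smooth_on_power2 smooth_on_inverse smooth_on_sqrt smooth_on_cis smooth_on_Re smooth_on_Im
  smooth_on_cnj smooth_on_fst smooth_on_snd smooth_on_vec_nth smooth_on_of_real
  smooth_on_cmod_power2 smooth_on_cmod smooth_on_Pair smooth_on_Complex smooth_on_vector3
  smooth_on_vector2

lemma smooth_on_imp_continuous_on: "smooth_on U f \<Longrightarrow> continuous_on U f"
  using Ck_on.simps(1) unfolding smooth_on_def by blast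

lemma smooth_on_imp_differentiable_at: "smooth_on U f \<Longrightarrow> x \<in> U \<Longrightarrow> f differentiable at x"
  by (metis Ck_on.simps(2) differentiable_on_eq_differentiable_at smooth_on_def)

lemma smooth_on_imp_smooth_map_on: "smooth_on U f \<Longrightarrow> A \<subseteq> U \<Longrightarrow> smooth_map_on A f"
  unfolding smooth_map_on_def by blast

lemma has_derivative_vec:
  fixes f :: "'a::real_normed_vector \<Rightarrow> 'b::euclidean_space ^ 'n"
  assumes "\<And>i. ((\<lambda>x. f x $ i) has_derivative (\<lambda>h. f' h $ i)) F"
  shows "(f has_derivative f') F"
proof -
  have "((\<lambda>x. \<Sum>i\<in>UNIV. axis i (f x $ i)) has_derivative (\<lambda>h. \<Sum>i\<in>UNIV. axis i (f' h $ i))) F"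
    by (intro has_derivative_sum bounded_linear.has_derivative[OF bounded_linear_axis] assms)
  then show ?thesis by (simp add: sum_axis)
qed

lemma continuous_on_vector3:
  assumes "continuous_on S f" "continuous_on S g" "continuous_on S h"
  shows "continuous_on S (\<lambda>x. vector [f x, g x, h x] :: 'b::real_normed_vector^3)"
proof -
  have "continuous_on S (\<lambda>x. (vector [f x, g x, h x] :: 'b^3) $ i)" for i
    using exhaust_3[of i] assms by auto
  then have "continuous_on S (\<lambda>x. \<chi> i. (vector [f x, g x, h x] :: 'b^3) $ i)"
    by (rule continuous_on_vec_lambda)
  then show ?thesis by simp
qed

section \<open>The map and its fibres\<close>

lemma F_fib_eq:
  "F_fib z = (((cmod (z$1))\<^sup>2 - (cmod (z$2))\<^sup>2) / 2,
     z$3 - cnj (z$1 * z$2) / complex_of_real (max (cmod (z$1)) (cmod (z$2))))"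
proof -
  \<comment> \<open>The sign of \<open>a\<close> decides which modulus is the maximum, hence which
    denominator occurs.\<close>
  have "(cmod (z$1))\<^sup>2 - (cmod (z$2))\<^sup>2 \<ge> 0 \<longleftrightarrow> cmod (z$2) \<le> cmod (z$1)"
    by (simp add: abs_le_square_iff[symmetric])
  then show ?thesis
    by (auto simp: F_fib_def Let_def max_def)
qed

text \<open>A number \<open>w\<close> whose product with \<open>P\<close> is real and nonnegative
  points in the direction of \<open>cnj P\<close>, so its length determines it. The last hypothesis
  covers \<open>P = 0\<close>: it forces \<open>n = 0\<close>, and both sides then say
  \<open>w = 0\<close>. It is applied with \<open>P = z1 z2\<close> and with \<open>m\<close>,
  \<open>n\<close> the larger and smaller of the two moduli.\<close>

lemma eq_cnj_divide_iff:
  assumes "m \<ge> 0" "n \<ge> 0" "cmod P = m * n" "m = 0 \<longrightarrow> n = 0"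
  shows "w = cnj P / complex_of_real m \<longleftrightarrow> cmod w = n \<and> Im (P * w) = 0 \<and> Re (P * w) \<ge> 0"
proof
  assume w: "w = cnj P / complex_of_real m"
  then have "P * w = complex_of_real ((m * n)\<^sup>2 / m)"
    using complex_norm_square[of P] assms(3) by simp
  then show "cmod w = n \<and> Im (P * w) = 0 \<and> Re (P * w) \<ge> 0"
    using w assms by (auto simp: norm_divide)
next
  assume w: "cmod w = n \<and> Im (P * w) = 0 \<and> Re (P * w) \<ge> 0"
  then have Pw: "P * w = complex_of_real (cmod (P * w))"
    by (intro complex_eqI) (auto simp: cmod_eq_Re simp del: times_complex.sel)
  show "w = cnj P / complex_of_real m"
  proof (cases "P = 0")
    case True
    then show ?thesis using w assms by auto
  next
    case False
    \<comment> \<open>Multiplying \<open>P * w = |P * w|\<close> by \<open>cnj P\<close> gives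
      \<open>(m n)^2 w = m n^2 cnj P\<close>, from which \<open>m n^2\<close> can be
      cancelled.\<close>
    have "cnj P * (P * w) = cnj P * complex_of_real (m * n * n)"
      using Pw w assms(3) by (simp add: norm_mult)
    moreover have "cnj P * P = complex_of_real ((m * n)\<^sup>2)"
      using complex_norm_square[of P] assms(3) by (simp add: mult.commute)
    ultimately have "complex_of_real ((m * n)\<^sup>2) * w = cnj P * complex_of_real (m * n * n)"
      by (metis mult.assoc)
    moreover have "m \<noteq> 0" "n \<noteq> 0" using False assms(3) by auto
    ultimately show ?thesis by (simp add: field_simps power2_eq_square)
  qed
qed

lemma F_fib_eq_iff: "F_fib z = (a, c) \<longleftrightarrow> z \<in> N_ac a c"
proof -
  define m where "m = max (cmod (z$1)) (cmod (z$2))"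
  define n where "n = min (cmod (z$1)) (cmod (z$2))"
  have mn: "m \<ge> 0" "n \<ge> 0" "cmod (z$1 * z$2) = m * n" "m = 0 \<longrightarrow> n = 0"
    by (auto simp: m_def n_def norm_mult max_def min_def)
  \<comment> \<open>The term \<open>\<bar>a\<bar>\<close> makes the second equation of
    \<open>N_ac\<close> say that \<open>|z3 - c|\<close> is the smaller modulus: for
    \<open>a \<ge> 0\<close> it reads \<open>|z3 - c|^2 = |z2|^2\<close>, and for
    \<open>a < 0\<close> it reads \<open>|z3 - c|^2 = |z2|^2 + 2a = |z1|^2\<close>.\<close>
  have *: "(cmod (z$3 - c))\<^sup>2 = n\<^sup>2 \<longleftrightarrow> (cmod (z$2))\<^sup>2 + a = (cmod (z$3 - c))\<^sup>2 + \<bar>a\<bar>"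
    if "(cmod (z$1))\<^sup>2 - a = (cmod (z$2))\<^sup>2 + a"
  proof (cases "cmod (z$2) \<le> cmod (z$1)")
    case True
    then have "(cmod (z$2))\<^sup>2 \<le> (cmod (z$1))\<^sup>2" by (simp add: power_mono)
    then have "a \<ge> 0" using that by linarith
    then show ?thesis using True by (auto simp: n_def min_def)
  next
    case False
    then have "(cmod (z$1))\<^sup>2 < (cmod (z$2))\<^sup>2" by (simp add: power_strict_mono)
    then have "a < 0" using that by linarith
    then show ?thesis using False that by (auto simp: n_def min_def)
  qed
  have "F_fib z = (a, c) \<longleftrightarrow> (cmod (z$1))\<^sup>2 - a = (cmod (z$2))\<^sup>2 + a \<and>
      z$3 - c = cnj (z$1 * z$2) / complex_of_real m"
    by (auto simp: F_fib_eq m_def field_simps)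
  also have "\<dots> \<longleftrightarrow> z \<in> N_ac a c"
    unfolding eq_cnj_divide_iff[OF mn] N_ac_def using * mn(2) by (auto simp: power2_eq_iff_nonneg)
  finally show ?thesis .
qed

text \<open>For \<open>a \<ge> 0\<close> the maximum is \<open>|z1|\<close>, so the fibre is a graph
  over a hypersurface in the \<open>(z1, z2)\<close> plane; this form feeds all later
  parametrisations.\<close>

lemma N_ac_iff:
  assumes "a \<ge> 0"
  shows "z \<in> N_ac a c \<longleftrightarrow> (cmod (z$1))\<^sup>2 = (cmod (z$2))\<^sup>2 + 2 * a \<and>
    z$3 = c + cnj (z$1 * z$2) / complex_of_real (cmod (z$1))"
proof -
  have "max (cmod (z$1)) (cmod (z$2)) = cmod (z$1)" if "(cmod (z$1))\<^sup>2 = (cmod (z$2))\<^sup>2 + 2 * a"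
  proof -
    have "(cmod (z$2))\<^sup>2 \<le> (cmod (z$1))\<^sup>2" using that assms by simp
    then show ?thesis by (simp add: max_def power2_le_iff_abs_le)
  qed
  then show ?thesis
    unfolding F_fib_eq_iff[symmetric] F_fib_eq by (auto simp: field_simps)
qed

lemma vimage_F_fib: "F_fib -` {(a, c)} = N_ac a c"
  by (auto simp: F_fib_eq_iff)

section \<open>Continuity, closed fibres and surjectivity\<close>

lemma continuous_F_fib: "continuous_on UNIV F_fib"
proof -
  let ?m = "\<lambda>z::complex^3. max (cmod (z$1)) (cmod (z$2))"
  let ?q = "\<lambda>z::complex^3. cnj (z$1 * z$2) / complex_of_real (?m z)"
  have "isCont ?q z" for z
  proof (cases "?m z = 0")
    case False
    then show ?thesis
      by (intro continuous_intros) auto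
  next
    case True
    then have z: "z$1 = 0" by (auto simp: max_def split: if_splits)
    \<comment> \<open>Since \<open>|y2|\<close> is at most the maximum, the quotient is bounded by
      \<open>|y1|\<close>; where the maximum is zero the quotient is \<open>0\<close> by the
      convention \<open>0/0 = 0\<close>. This gives the limit at points with
      \<open>z1 = z2 = 0\<close>, the only ones where the denominator vanishes.\<close>
    have "norm (?q y) \<le> norm (y$1)" for y
      by (cases "?m y = 0") (auto simp: norm_mult norm_divide field_simps intro!: mult_left_mono)
    then have bound: "\<forall>\<^sub>F y in at z. norm (?q y) \<le> norm (y$1)"
      by (rule always_eventually[OF allI])
    have "((\<lambda>y::complex^3. y$1) \<longlongrightarrow> 0) (at z)"
      by (intro tendsto_eq_intros) (auto simp: z)
    then have "(?q \<longlongrightarrow> 0) (at z)"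
      by (rule Lim_null_comparison[OF bound tendsto_norm_zero])
    then show ?thesis using z by (simp add: isCont_def)
  qed
  then have q: "continuous_on UNIV ?q" by (simp add: continuous_at_imp_continuous_on)
  show ?thesis
    unfolding F_fib_eq[abs_def]
    by (intro continuous_on_Pair continuous_on_diff[OF _ q]) (intro continuous_intros; simp)+
qed

lemma closed_N_ac: "closed (N_ac a c)"
  unfolding vimage_F_fib[symmetric] by (rule closed_vimage[OF closed_singleton continuous_F_fib])

text \<open>Points with \<open>z1 z2 = 0\<close> suffice: the correction term vanishes, so
  \<open>z3 = c\<close>, and the modulus of the other coordinate is chosen to produce
  \<open>a\<close>.\<close>

lemma surj_F_fib: "range F_fib = UNIV"
proof -
  have "\<exists>z. F_fib z = (a, c)" for a c
  proof (cases "a \<ge> 0")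
    case True
    then show ?thesis
      by (intro exI[of _ "vector [complex_of_real (sqrt (2 * a)), 0, c]"]) (simp add: F_fib_eq)
  next
    case False
    then show ?thesis
      by (intro exI[of _ "vector [0, complex_of_real (sqrt (- 2 * a)), c]"]) (simp add: F_fib_eq)
  qed
  then show ?thesis by (metis surj_def surj_pair)
qed

section \<open>The smooth pieces, and failure of smoothness where they meet\<close>

lemma F_fib_piecewise_smooth:
  "\<exists>g1 g2 :: complex^3 \<Rightarrow> real \<times> complex.
     smooth_on {z. z$1 \<noteq> 0} g1 \<and> smooth_on {z. z$2 \<noteq> 0} g2 \<and>
     (\<forall>z. cmod (z$1) \<ge> cmod (z$2) \<and> z$1 \<noteq> 0 \<longrightarrow> F_fib z = g1 z) \<and>
     (\<forall>z. cmod (z$1) \<le> cmod (z$2) \<and> z$2 \<noteq> 0 \<longrightarrow> F_fib z = g2 z)"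
proof -
  \<comment> \<open>Fixing the denominator as \<open>|z_i|\<close> extends a piece smoothly across
    the hypersurface to all of \<open>z_i \<noteq> 0\<close>. Products with \<open>1/2\<close> and
    \<open>inverse\<close> match the shape of the smoothness rules.\<close>
  let ?g = "\<lambda>i. \<lambda>z::complex^3. (((cmod (z$1))\<^sup>2 - (cmod (z$2))\<^sup>2) * (1/2),
    z$3 - cnj (z$1 * z$2) * complex_of_real (inverse (cmod (z$i))))"
  have "open {z::complex^3. z$i \<noteq> 0}" for i
    by (intro open_Collect_neq continuous_intros)
  then have "smooth_on {z. z$i \<noteq> 0} (?g i)" for i
    by (intro smooth_on_intros) auto
  then show ?thesis
    by (intro exI[of _ "?g 1"] exI[of _ "?g 2"]) (auto simp: F_fib_eq max_def field_simps)
qed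

lemma F_fib_not_differentiable:
  assumes "cmod (z$1) = cmod (z$2)" "z$1 \<noteq> 0"
  shows "\<not> F_fib differentiable at z"
proof
  assume "F_fib differentiable at z"
  then have F: "(F_fib has_derivative frechet_derivative F_fib (at z)) (at z)"
    by (simp add: frechet_derivative_works)
  define \<gamma> where "\<gamma> = (\<lambda>t::real. z + t *\<^sub>R axis 1 (z$1))"
  define K where "K = cnj (z$1 * z$2) / complex_of_real (cmod (z$1))"
  define D where "D = snd (frechet_derivative F_fib (at z) (axis 1 (z$1)))"
  have "(\<gamma> has_derivative (\<lambda>t. t *\<^sub>R axis 1 (z$1))) (at 0)"
    unfolding \<gamma>_def by (auto intro!: derivative_eq_intros)
  moreover have "\<gamma> 0 = z" by (simp add: \<gamma>_def)
  ultimately have "((\<lambda>t. snd (F_fib (\<gamma> t))) has_derivative (\<lambda>t. snd (frechet_derivative F_fib (at z) (t *\<^sub>R axis 1 (z$1))))) (at 0)"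
    using F by (intro has_derivative_snd) (metis has_derivative_compose)
  then have D: "((\<lambda>t. snd (F_fib (\<gamma> t))) has_vector_derivative D) (at 0)"
    using linear_scale[OF has_derivative_linear[OF F]] by (simp add: has_vector_derivative_def D_def)
  \<comment> \<open>The curve scales \<open>z1\<close> by \<open>1 + t\<close>; because
    \<open>|z1| = |z2|\<close>, the maximum becomes \<open>|z1| * max (1 + t) 1\<close>. The bound
    on \<open>t\<close> ensures \<open>|1 + t| = 1 + t\<close>.\<close>
  have val: "snd (F_fib (\<gamma> t)) = z$3 - cnj (z$1 * z$2) * (1 + t) / complex_of_real (cmod (z$1) * max (1 + t) 1)"
    if "t \<ge> -1" for t
  proof -
    have "\<gamma> t $ 1 = complex_of_real (1 + t) * z$1" "\<gamma> t $ 2 = z$2" "\<gamma> t $ 3 = z$3"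
      by (simp_all add: \<gamma>_def axis_def scaleR_conv_of_real[of _ "z$1"] algebra_simps)
    moreover have "max (cmod (complex_of_real (1 + t) * z$1)) (cmod (z$2)) = cmod (z$1) * max (1 + t) 1"
    proof -
      have eq: "cmod (complex_of_real (1 + t) * z$1) = (1 + t) * cmod (z$1)"
        using that by (simp only: norm_mult norm_of_real)
      show ?thesis
        unfolding eq using assms max_mult_distrib_left[of "cmod (z$1)" "1 + t" 1]
        by (simp add: algebra_simps)
    qed
    ultimately show ?thesis by (simp add: F_fib_eq mult_ac)
  qed
  \<comment> \<open>For \<open>t \<ge> 0\<close> the factor \<open>1 + t\<close> cancels, so the
    second component is constant on the right.\<close>
  have "((\<lambda>t::real. z$3 - K) has_vector_derivative D) (at 0 within cbox 0 1)"
  proof (rule has_vector_derivative_transform[OF _ _ has_vector_derivative_at_within[OF D]])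
    show "z$3 - K = snd (F_fib (\<gamma> t))" if "t \<in> cbox 0 1" for t
    proof -
      have "complex_of_real (1 + t) \<noteq> 0" using that by (simp only: of_real_eq_0_iff) auto
      then show ?thesis
        using that assms by (simp add: val K_def max_def field_simps flip: of_real_add)
    qed
  qed auto
  then have "D = 0"
    using vector_derivative_unique_within_closed_interval[of 0 1 0 _ D 0] by auto
  \<comment> \<open>For \<open>t \<le> 0\<close> the maximum stays at \<open>|z1|\<close>, so the
    component is affine with slope \<open>- K\<close>.\<close>
  have "((\<lambda>t::real. z$3 - K * (1 + t)) has_vector_derivative D) (at 0 within cbox (-1) 0)"
    by (rule has_vector_derivative_transform[OF _ _ has_vector_derivative_at_within[OF D]])
      (auto simp: val K_def max_def field_simps)
  moreover have "((\<lambda>t::real. z$3 - K * (1 + t)) has_vector_derivative - K) (at 0 within cbox (-1) 0)"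
    by (auto intro!: derivative_eq_intros)
  ultimately have "D = - K"
    using vector_derivative_unique_within_closed_interval[of "-1" 0 0 _ D "- K"] by auto
  \<comment> \<open>\<open>K \<noteq> 0\<close>, because \<open>z2\<close> has the same nonzero
    modulus as \<open>z1\<close>.\<close>
  with \<open>D = 0\<close> show False
    using assms by (auto simp: K_def)
qed

lemma F_fib_not_smooth_at:
  assumes "cmod (z$1) = cmod (z$2)"
  shows "\<not> smooth_at F_fib z"
proof
  assume "smooth_at F_fib z"
  then obtain U where U: "open U" "z \<in> U" "smooth_on U F_fib" unfolding smooth_at_def by blast
  then obtain e where e: "e > 0" "\<And>y. dist y z < e \<Longrightarrow> y \<in> U" by (metis openE mem_ball dist_commute subsetD)
  \<comment> \<open>Where both coordinates vanish, move to a nearby point of the hypersurface where they do not.\<close>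
  define y where "y = (if z$1 = 0 then z + complex_of_real (e/4) *s vector [1, 1, 0] else z)"
  have "y \<in> U"
  proof (cases "z$1 = 0")
    case True
    \<comment> \<open>The coordinates of \<open>y - z\<close> have moduli \<open>e/4\<close>,
      \<open>e/4\<close> and \<open>0\<close>.\<close>
    have "norm (y - z) \<le> (\<Sum>i\<in>UNIV. norm ((y - z) $ i))" unfolding norm_vec_def by (rule L2_set_le_sum) simp
    also have "\<dots> < e" using True e(1) by (simp add: y_def sum_3 norm_mult)
    finally show ?thesis using e(2) by (simp add: dist_norm)
  qed (use U in \<open>simp add: y_def\<close>)
  moreover have "cmod (y$1) = cmod (y$2)" "y$1 \<noteq> 0"
    using assms e(1) by (auto simp: y_def)
  ultimately show False
    using F_fib_not_differentiable U(3) smooth_on_imp_differentiable_at by blast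
qed

section \<open>Special Lagrangian charts\<close>

text \<open>\<open>t$1\<close> is an argument of \<open>z1\<close> and
  \<open>Complex (t$2) (t$3)\<close> is \<open>z2\<close>; the modulus of \<open>z1\<close> and the
  value of \<open>z3\<close> are then forced by \<open>N_ac_iff\<close>.\<close>

definition SL_chart :: "real \<Rightarrow> complex \<Rightarrow> real^3 \<Rightarrow> complex^3" where
  "SL_chart a c t = vector [cis (t$1) * complex_of_real (sqrt ((t$2)\<^sup>2 + (t$3)\<^sup>2 + 2 * a)),
     Complex (t$2) (t$3), c + cis (- (t$1)) * Complex (t$2) (- (t$3))]"

text \<open>The differential of the chart at \<open>t\<close> in direction \<open>h\<close>, with
  \<open>R\<close> standing for \<open>|z1|\<close>. Keeping \<open>R\<close> as a parameter and
  pulling out the rotations leaves entries rational in \<open>t\<close>, \<open>h\<close> and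
  \<open>R\<close>; the pointwise conditions below hold for every \<open>R > 0\<close>.\<close>

definition SL_chart_deriv :: "real \<Rightarrow> real^3 \<Rightarrow> real^3 \<Rightarrow> complex^3" where
  "SL_chart_deriv R t h = vector [cis (t$1) * Complex ((t$2 * h$2 + t$3 * h$3) / R) (h$1 * R),
     Complex (h$2) (h$3), cis (- (t$1)) * Complex (h$2 - h$1 * t$3) (- (h$3) - h$1 * t$2)]"

lemma has_derivative_SL_chart:
  assumes "(t$2)\<^sup>2 + (t$3)\<^sup>2 + 2 * a > 0"
  shows "(SL_chart a c has_derivative SL_chart_deriv (sqrt ((t$2)\<^sup>2 + (t$3)\<^sup>2 + 2 * a)) t) (at t)"
proof (rule has_derivative_vec)
  have nth: "((\<lambda>t. t$i) has_derivative (\<lambda>h. h$i)) (at t)" for i and t :: "real^3"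
    by (rule bounded_linear_imp_has_derivative[OF bounded_linear_vec_nth])
  have c1: "((\<lambda>t::real^3. cis (t$1)) has_derivative (\<lambda>h. h$1 *\<^sub>R (\<i> * cis (t$1)))) (at t)"
    by (rule has_derivative_compose[OF nth has_derivative_cis])
  have c2: "((\<lambda>t::real^3. cis (- (t$1))) has_derivative (\<lambda>h. (- (h$1)) *\<^sub>R (\<i> * cis (- (t$1))))) (at t)"
    by (rule has_derivative_compose[OF has_derivative_minus[OF nth] has_derivative_cis])
  have u: "((\<lambda>t::real^3. Complex (t$2) (s * t$3)) has_derivative (\<lambda>h. Complex (h$2) (s * h$3))) (at t)" for s
    unfolding Complex_eq by (auto intro!: derivative_eq_intros nth)
  have r: "((\<lambda>t::real^3. sqrt ((t$2)\<^sup>2 + (t$3)\<^sup>2 + 2 * a)) has_derivative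
      (\<lambda>h. (t$2 * h$2 + t$3 * h$3) / sqrt ((t$2)\<^sup>2 + (t$3)\<^sup>2 + 2 * a))) (at t)"
    using assms by (auto intro!: derivative_eq_intros nth simp: field_simps)
  fix i :: 3
  consider "i = 1" | "i = 2" | "i = 3" using exhaust_3 by blast
  then show "((\<lambda>t. SL_chart a c t $ i) has_derivative
      (\<lambda>h. SL_chart_deriv (sqrt ((t$2)\<^sup>2 + (t$3)\<^sup>2 + 2 * a)) t h $ i)) (at t)"
  proof cases
    case 1
    then show ?thesis
      using has_derivative_mult[OF c1 has_derivative_of_real[OF r]]
      by (auto simp: SL_chart_def SL_chart_deriv_def fun_eq_iff complex_eq_iff algebra_simps
          elim!: has_derivative_eq_rhs)
  next
    case 2
    then show ?thesis
      using u[of 1] by (simp add: SL_chart_def SL_chart_deriv_def)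
  next
    case 3
    then show ?thesis
      using has_derivative_add[OF has_derivative_const[of c] has_derivative_mult[OF c2 u[of "-1"]]]
      by (auto simp: SL_chart_def SL_chart_deriv_def fun_eq_iff complex_eq_iff algebra_simps
          elim!: has_derivative_eq_rhs)
  qed
qed

lemma SL_chart_deriv_inj:
  assumes "R > 0"
  shows "inj (SL_chart_deriv R t)"
proof (rule injI)
  fix h k assume "SL_chart_deriv R t h = SL_chart_deriv R t k"
  then have "SL_chart_deriv R t h $ i = SL_chart_deriv R t k $ i" for i by simp
  from this[of 1] this[of 2] have "h$2 = k$2" "h$3 = k$3" "h$1 * R = k$1 * R"
    by (auto simp: SL_chart_deriv_def)
  then show "h = k" using assms by (simp add: vec_eq_iff forall_3)
qed

text \<open>The rotations cancel in each product \<open>cnj u_j * v_j\<close>, and the contribution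
  of the third coordinate is minus the sum of the other two.\<close>

lemma SL_chart_deriv_omega:
  assumes "R > 0"
  shows "omega_C3 (SL_chart_deriv R t h) (SL_chart_deriv R t k) = 0"
proof -
  have cis: "cnj (cis s * A) * (cis s * B) = cnj A * B" for s A B
  proof -
    have "cnj (cis s) * cis s = 1" by (simp add: cis_cnj cis_mult)
    then show ?thesis by (simp add: algebra_simps)
  qed
  have "omega_C3 (SL_chart_deriv R t h) (SL_chart_deriv R t k) =
      (t$2 * h$2 + t$3 * h$3) / R * (k$1 * R) - (h$1 * R) * ((t$2 * k$2 + t$3 * k$3) / R)
      + (h$2 * k$3 - h$3 * k$2)
      + ((h$2 - h$1 * t$3) * (- (k$3) - k$1 * t$2) - (- (h$3) - h$1 * t$2) * (k$2 - k$1 * t$3))"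
    unfolding omega_C3_def SL_chart_deriv_def sum_3 vector_3 cis using assms by (simp add: field_simps)
  also have "\<dots> = 0" using assms by (simp add: field_simps)
  finally show ?thesis .
qed

lemma Omega_C3_expand:
  "Omega_C3 u v w = u$1 * v$2 * w$3 + u$2 * v$3 * w$1 + u$3 * v$1 * w$2
     - u$1 * v$3 * w$2 - u$2 * v$1 * w$3 - u$3 * v$2 * w$1"
  by (simp add: Omega_C3_def det_3)

text \<open>Every term of the determinant takes one entry from each column, so
  \<open>cis (t$1)\<close> meets \<open>cis (- (t$1))\<close> and they cancel. The remaining
  imaginary part splits into a \<open>1/R\<close> and an \<open>R\<close> part, both sums of
  determinants with dependent columns.\<close>

lemma SL_chart_deriv_Omega:
  assumes "R > 0"
  shows "Im (Omega_C3 (SL_chart_deriv R t h) (SL_chart_deriv R t k) (SL_chart_deriv R t l)) = 0"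
proof -
  let ?v = "\<lambda>h::real^3. vector [Complex ((t$2 * h$2 + t$3 * h$3) * (1 / R)) (h$1 * R),
     Complex (h$2) (h$3), Complex (h$2 - h$1 * t$3) (- (h$3) - h$1 * t$2)] :: complex^3"
  have e: "cis (t$1) * cis (- (t$1)) = 1" by (simp add: cis_mult)
  have d: "SL_chart_deriv R t h $ 1 = cis (t$1) * ?v h $ 1" "SL_chart_deriv R t h $ 2 = ?v h $ 2"
      "SL_chart_deriv R t h $ 3 = cis (- (t$1)) * ?v h $ 3" for h
    by (auto simp: SL_chart_deriv_def)
  have "Omega_C3 (SL_chart_deriv R t h) (SL_chart_deriv R t k) (SL_chart_deriv R t l) =
      Omega_C3 (?v h) (?v k) (?v l)"
    unfolding Omega_C3_expand d using e by algebra
  also have "Im \<dots> = 0"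
    unfolding Omega_C3_expand vector_3 by (simp add: algebra_simps)
  finally show ?thesis .
qed

lemma smooth_on_SL_chart:
  assumes "open V" "\<And>t. t \<in> V \<Longrightarrow> (t$2)\<^sup>2 + (t$3)\<^sup>2 + 2 * a > 0"
  shows "smooth_on V (SL_chart a c)"
  unfolding SL_chart_def[abs_def] by (intro smooth_on_intros assms)

lemma SL_submanifold_N_ac:
  assumes "a \<ge> 0"
  shows "SL_submanifold (N_ac a c \<inter> {z. z$1 \<noteq> 0})"
  unfolding SL_submanifold_def
proof
  let ?L = "N_ac a c \<inter> {z. z$1 \<noteq> 0}"
  fix p assume "p \<in> ?L"
  then have p: "p$1 \<noteq> 0" by simp
  define \<theta> where "\<theta> = Arg (p$1)"
  \<comment> \<open>Removing the closed ray opposite to \<open>p$1\<close> makes the rotated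
    argument in \<open>\<psi>\<close> continuous.\<close>
  define U where "U = {z::complex^3. z$1 * cis (- \<theta>) \<notin> \<real>\<^sub>\<le>\<^sub>0}"
  \<comment> \<open>The angle runs over one full open turn centred at \<open>\<theta>\<close>. The
    second condition matters for \<open>a = 0\<close>, where it excludes the zero of the square
    root, which is the vertex.\<close>
  define V where "V = {t::real^3. \<bar>t$1 - \<theta>\<bar> < pi \<and> (t$2)\<^sup>2 + (t$3)\<^sup>2 + 2 * a > 0}"
  define \<psi> where "\<psi> = (\<lambda>z::complex^3. vector [\<theta> + Arg (z$1 * cis (- \<theta>)), Re (z$2), Im (z$2)] :: real^3)"
  let ?R = "\<lambda>t::real^3. sqrt ((t$2)\<^sup>2 + (t$3)\<^sup>2 + 2 * a)"
  have "open U"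
  proof -
    have "U = (\<lambda>z. z$1 * cis (- \<theta>)) -` (- \<real>\<^sub>\<le>\<^sub>0)" by (auto simp: U_def)
    moreover have "open \<dots>" by (intro open_vimage continuous_intros) auto
    ultimately show ?thesis by simp
  qed
  have "open V"
    unfolding V_def by (intro open_Collect_conj open_Collect_less continuous_intros)
  have "p \<in> U"
  proof -
    have "p$1 * cis (- \<theta>) = complex_of_real (cmod (p$1))"
      using p rcis_cmod_Arg[of "p$1"] by (metis \<theta>_def cis_divide cis_mult cis_zero mult.assoc mult.right_neutral rcis_def add.right_inverse)
    then show ?thesis using p by (simp add: U_def)
  qed
  have smooth: "smooth_on V (SL_chart a c)"
    by (rule smooth_on_SL_chart[OF \<open>open V\<close>]) (simp add: V_def)
  have rot: "SL_chart a c t $ 1 * cis (- \<theta>) = complex_of_real (?R t) * cis (t$1 - \<theta>)" for t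
    by (simp add: SL_chart_def cis_mult mult_ac)
  have homeo: "homeomorphism V (?L \<inter> U) (SL_chart a c) \<psi>"
  proof (rule homeomorphismI)
    show "continuous_on V (SL_chart a c)" by (rule smooth_on_imp_continuous_on[OF smooth])
    show "continuous_on (?L \<inter> U) \<psi>"
    proof (rule continuous_on_subset)
      show "continuous_on U \<psi>"
        unfolding \<psi>_def
        by (intro continuous_on_vector3 continuous_intros) (simp add: U_def)
    qed auto
    show "SL_chart a c ` V \<subseteq> ?L \<inter> U"
    proof safe
      fix t assume t: "t \<in> V"
      then have R: "?R t > 0" by (simp add: V_def)
      have n1: "cmod (SL_chart a c t $ 1) = ?R t"
        using R by (simp add: SL_chart_def norm_mult)
      then show "SL_chart a c t $ 1 = 0 \<Longrightarrow> False" using R by simp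
      have "(?R t)\<^sup>2 = (cmod (Complex (t$2) (t$3)))\<^sup>2 + 2 * a"
        using R by (simp add: cmod_power2)
      moreover have "cnj (SL_chart a c t $ 1 * SL_chart a c t $ 2) / complex_of_real (?R t) =
          cis (- (t$1)) * Complex (t$2) (- (t$3))"
        using R by (simp add: SL_chart_def cis_cnj complex_eq_iff)
      ultimately show "SL_chart a c t \<in> N_ac a c"
        unfolding N_ac_iff[OF assms] n1 by (simp add: SL_chart_def)
      show "SL_chart a c t \<in> U"
      proof -
        have "complex_of_real (?R t) * cis (t$1 - \<theta>) \<notin> \<real>\<^sub>\<le>\<^sub>0"
        proof
          assume "complex_of_real (?R t) * cis (t$1 - \<theta>) \<in> \<real>\<^sub>\<le>\<^sub>0"
          then have "?R t * cos (t$1 - \<theta>) \<le> 0" "?R t * sin (t$1 - \<theta>) = 0"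
            by (auto simp: complex_nonpos_Reals_iff)
          \<comment> \<open>Within the angle window a vanishing sine forces angle zero, where the
            cosine is positive.\<close>
          then have "sin (t$1 - \<theta>) = 0" "cos (t$1 - \<theta>) \<le> 0"
            using R by (auto simp: mult_le_0_iff)
          moreover from this have "t$1 - \<theta> = 0"
            using t by (intro sin_eq_0_pi[of "t$1 - \<theta>"]) (auto simp: V_def)
          ultimately show False by simp
        qed
        then show ?thesis by (simp add: U_def rot)
      qed
    qed
    have inv: "\<psi> z \<in> V \<and> SL_chart a c (\<psi> z) = z" if z: "z \<in> ?L \<inter> U" for z
    proof -
      let ?w = "z$1 * cis (- \<theta>)"
      have w: "?w \<noteq> 0" "?w \<notin> \<real>\<^sub>\<le>\<^sub>0" using z by (auto simp: U_def)
      have "\<bar>Arg ?w\<bar> < pi"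
        using Arg_bounded[of ?w] Arg_eq_pi[of ?w] w by (auto simp: complex_nonpos_Reals_iff abs_less_iff less_le)
      have N: "(cmod (z$1))\<^sup>2 = (cmod (z$2))\<^sup>2 + 2 * a"
          "z$3 = c + cnj (z$1 * z$2) / complex_of_real (cmod (z$1))" "z$1 \<noteq> 0"
        using z N_ac_iff[OF assms] by auto
      have R2: "(\<psi> z $ 2)\<^sup>2 + (\<psi> z $ 3)\<^sup>2 + 2 * a = (cmod (z$1))\<^sup>2"
        unfolding N(1) by (simp add: \<psi>_def cmod_power2)
      \<comment> \<open>Undoing the rotation by \<open>\<theta>\<close> turns the recovered angle
        into the phase \<open>z1 / |z1|\<close>; its conjugate is the phase needed for the third
        coordinate.\<close>
      have cis1: "cis (\<psi> z $ 1) = z$1 / complex_of_real (cmod (z$1))"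
      proof -
        have "cis (\<psi> z $ 1) = cis \<theta> * sgn ?w"
          using w by (simp add: \<psi>_def cis_Arg flip: cis_mult)
        also have "\<dots> = z$1 * (cis \<theta> * cis (- \<theta>)) / complex_of_real (cmod (z$1))"
          by (simp add: sgn_eq norm_mult)
        finally show ?thesis by (simp add: cis_mult)
      qed
      have "cis (- (\<psi> z $ 1)) = cnj (z$1) / complex_of_real (cmod (z$1))"
        using arg_cong[OF cis1, of cnj] by (simp add: cis_cnj)
      then have "SL_chart a c (\<psi> z) $ i = z $ i" for i
        using exhaust_3[of i] N(2,3) cis1
        unfolding SL_chart_def R2 by (auto simp: \<psi>_def complex_eq_iff diff_divide_distrib)
      then show ?thesis
        using \<open>\<bar>Arg ?w\<bar> < pi\<close> R2 N(3) by (auto simp: V_def \<psi>_def vec_eq_iff)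
    qed
    then show "\<psi> ` (?L \<inter> U) \<subseteq> V" "\<And>z. z \<in> ?L \<inter> U \<Longrightarrow> SL_chart a c (\<psi> z) = z" by auto
    show "\<psi> (SL_chart a c t) = t" if t: "t \<in> V" for t
    proof -
      have "Arg (complex_of_real (?R t) * cis (t$1 - \<theta>)) = t$1 - \<theta>"
        using t by (intro Arg_unique[of "?R t"]) (auto simp: V_def cis_conv_exp)
      then show ?thesis
        unfolding \<psi>_def rot by (simp add: SL_chart_def vec_eq_iff forall_3)
    qed
  qed
  have "frechet_derivative (SL_chart a c) (at t) = SL_chart_deriv (?R t) t" if "t \<in> V" for t
    using frechet_derivative_at[OF has_derivative_SL_chart] that by (simp add: V_def)
  moreover have "?R t > 0" if "t \<in> V" for t
    using that by (simp add: V_def)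
  ultimately have "\<forall>t\<in>V. inj (frechet_derivative (SL_chart a c) (at t)) \<and>
      (\<forall>h k. omega_C3 (frechet_derivative (SL_chart a c) (at t) h) (frechet_derivative (SL_chart a c) (at t) k) = 0) \<and>
      (\<forall>h k l. Im (Omega_C3 (frechet_derivative (SL_chart a c) (at t) h) (frechet_derivative (SL_chart a c) (at t) k)
         (frechet_derivative (SL_chart a c) (at t) l)) = 0)"
    using SL_chart_deriv_inj SL_chart_deriv_omega SL_chart_deriv_Omega by simp
  then show "\<exists>U V \<phi> \<psi>. open U \<and> p \<in> U \<and> open (V :: (real^3) set) \<and>
        smooth_on V \<phi> \<and> homeomorphism V (?L \<inter> U) \<phi> \<psi> \<and>
        (\<forall>x\<in>V. inj (frechet_derivative \<phi> (at x)) \<and>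
           (\<forall>a b. omega_C3 (frechet_derivative \<phi> (at x) a) (frechet_derivative \<phi> (at x) b) = 0) \<and>
           (\<forall>a b c. Im (Omega_C3 (frechet_derivative \<phi> (at x) a) (frechet_derivative \<phi> (at x) b)
                                (frechet_derivative \<phi> (at x) c)) = 0))"
    using \<open>open U\<close> \<open>p \<in> U\<close> \<open>open V\<close> smooth homeo by blast
qed

section \<open>Exchange of the first two coordinates\<close>

definition swap12 :: "complex^3 \<Rightarrow> complex^3" where
  "swap12 z = vector [z$2, z$1, z$3]"

lemma swap12_nth [simp]: "swap12 z $ 1 = z$2" "swap12 z $ 2 = z$1" "swap12 z $ 3 = z$3"
  by (auto simp: swap12_def)

lemma swap12_swap12 [simp]: "swap12 (swap12 z) = z"
  by (simp add: vec_eq_iff forall_3)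

lemma bounded_linear_swap12: "bounded_linear swap12"
  by (rule linear_conv_bounded_linear[THEN iffD1], rule linearI) (simp_all add: vec_eq_iff forall_3)

lemma continuous_on_swap12: "continuous_on S swap12"
  by (rule linear_continuous_on[OF bounded_linear_swap12])

lemma image_swap12: "swap12 ` S = swap12 -` S"
proof
  show "swap12 -` S \<subseteq> swap12 ` S"
    by (metis imageI subsetI swap12_swap12 vimageE)
qed auto

lemma homeomorphism_swap12: "homeomorphism S (swap12 ` S) swap12 swap12"
  by (rule homeomorphismI) (auto simp: continuous_on_swap12)

lemma N_ac_uminus: "N_ac (- a) c = swap12 ` N_ac a c"
proof -
  have "swap12 z \<in> N_ac a c \<longleftrightarrow> z \<in> N_ac (- a) c" for z
    unfolding N_ac_def mem_Collect_eq swap12_nth mult.commute[of "z$2" "z$1"]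
    by (auto simp del: times_complex.sel)
  then show ?thesis unfolding image_swap12 by auto
qed

lemma omega_C3_swap12: "omega_C3 (swap12 u) (swap12 v) = omega_C3 u v"
  by (simp add: omega_C3_def sum_3)

lemma Omega_C3_swap12: "Omega_C3 (swap12 u) (swap12 v) (swap12 w) = - Omega_C3 u v w"
  by (simp add: Omega_C3_expand algebra_simps)

lemma inj_swap12: "inj swap12"
  by (metis injI swap12_swap12)

text \<open>Charts are composed with \<open>swap12\<close>: it preserves \<open>omega_C3\<close> and
  only changes the sign of \<open>Omega_C3\<close>, so both vanishing conditions survive.\<close>

lemma SL_submanifold_swap12:
  assumes "SL_submanifold L"
  shows "SL_submanifold (swap12 ` L)"
  unfolding SL_submanifold_def
proof
  fix p assume "p \<in> swap12 ` L"
  then have "swap12 p \<in> L" by (simp add: image_swap12)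
  then obtain U V \<phi> \<psi> where ch: "open U" "swap12 p \<in> U" "open (V :: (real^3) set)"
      "smooth_on V \<phi>" "homeomorphism V (L \<inter> U) \<phi> \<psi>"
      "\<forall>x\<in>V. inj (frechet_derivative \<phi> (at x)) \<and>
           (\<forall>a b. omega_C3 (frechet_derivative \<phi> (at x) a) (frechet_derivative \<phi> (at x) b) = 0) \<and>
           (\<forall>a b c. Im (Omega_C3 (frechet_derivative \<phi> (at x) a) (frechet_derivative \<phi> (at x) b)
                                (frechet_derivative \<phi> (at x) c)) = 0)"
    using assms unfolding SL_submanifold_def by meson
  have "open (swap12 ` U)"
    unfolding image_swap12 using open_vimage[OF ch(1) continuous_on_swap12] .
  moreover have "p \<in> swap12 ` U" using ch(2) by (simp add: image_swap12)
  moreover have "smooth_on V (\<lambda>x. swap12 (\<phi> x))"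
    by (rule smooth_on_linear[OF bounded_linear_swap12 ch(4)])
  moreover have "homeomorphism V (swap12 ` L \<inter> swap12 ` U) (\<lambda>x. swap12 (\<phi> x)) (\<psi> \<circ> swap12)"
    using homeomorphism_compose[OF ch(5) homeomorphism_swap12]
    by (simp add: image_Int[OF inj_swap12] o_def)
  moreover have "frechet_derivative (\<lambda>x. swap12 (\<phi> x)) (at x) = (\<lambda>h. swap12 (frechet_derivative \<phi> (at x) h))"
    if "x \<in> V" for x
    using smooth_on_imp_differentiable_at[OF ch(4) that] frechet_derivative_works
      bounded_linear.has_derivative[OF bounded_linear_swap12] frechet_derivative_at by metis
  moreover have "inj (\<lambda>h. swap12 (f h)) \<longleftrightarrow> inj f" for f :: "real^3 \<Rightarrow> complex^3"
    using inj_swap12 by (auto simp: inj_def)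
  ultimately show "\<exists>U V \<phi> \<psi>. open U \<and> p \<in> U \<and> open (V :: (real^3) set) \<and>
        smooth_on V \<phi> \<and> homeomorphism V (swap12 ` L \<inter> U) \<phi> \<psi> \<and>
        (\<forall>x\<in>V. inj (frechet_derivative \<phi> (at x)) \<and>
           (\<forall>a b. omega_C3 (frechet_derivative \<phi> (at x) a) (frechet_derivative \<phi> (at x) b) = 0) \<and>
           (\<forall>a b c. Im (Omega_C3 (frechet_derivative \<phi> (at x) a) (frechet_derivative \<phi> (at x) b)
                                (frechet_derivative \<phi> (at x) c)) = 0))"
    using ch(3,6)
    by (intro exI[of _ "swap12 ` U"] exI[of _ V] exI[of _ "\<lambda>x. swap12 (\<phi> x)"] exI[of _ "\<psi> \<circ> swap12"])
      (simp add: omega_C3_swap12 Omega_C3_swap12)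
qed

lemma diffeomorphic_swap12:
  assumes "diffeomorphic A B"
  shows "diffeomorphic (swap12 ` A) B"
proof -
  obtain f g where fg: "homeomorphism A B f g" "smooth_map_on A f" "smooth_map_on B g"
    using assms unfolding diffeomorphic_def by blast
  have "homeomorphism (swap12 ` A) B (f \<circ> swap12) (swap12 \<circ> g)"
    by (rule homeomorphism_compose[OF _ fg(1)]) (rule homeomorphism_symD[OF homeomorphism_swap12])
  moreover have "smooth_map_on (swap12 ` A) (f \<circ> swap12)"
    unfolding smooth_map_on_def
  proof
    fix x assume "x \<in> swap12 ` A"
    then have "swap12 x \<in> A" by (simp add: image_swap12)
    then obtain U h where h: "swap12 x \<in> U" "smooth_on U h" "\<forall>y\<in>A \<inter> U. h y = f y"
      using fg(2) unfolding smooth_map_on_def by blast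
    have o: "open (swap12 -` U)"
      using h(2) open_vimage[OF _ continuous_on_swap12] by (auto simp: smooth_on_def)
    have "smooth_on (swap12 -` U) (\<lambda>y. h (swap12 y))"
      by (rule smooth_on_compose[OF smooth_on_linear[OF bounded_linear_swap12 smooth_on_id[OF o]] h(2)]) auto
    then show "\<exists>U h. x \<in> U \<and> smooth_on U h \<and> (\<forall>y\<in>swap12 ` A \<inter> U. h y = (f \<circ> swap12) y)"
      using h by (intro exI[of _ "swap12 -` U"] exI[of _ "\<lambda>y. h (swap12 y)"]) (auto simp: image_swap12)
  qed
  moreover have "smooth_map_on B (swap12 \<circ> g)"
    using fg(3) smooth_on_linear[OF bounded_linear_swap12]
    unfolding smooth_map_on_def o_def by (metis (no_types, lifting))
  ultimately show ?thesis unfolding diffeomorphic_def by blast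
qed

section \<open>Diffeomorphism type and nonsingularity for \<open>a \<noteq> 0\<close>\<close>

text \<open>On the fibre \<open>|z1|^2 \<ge> 2a > 0\<close>, so the phase of \<open>z1\<close> is
  smooth; phase and \<open>z2\<close> together are global coordinates. In the inverse,
  \<open>R\<close> recovers \<open>|z1|\<close> from \<open>z2\<close> and is smooth because the
  radicand is positive.\<close>

lemma diffeomorphic_N_ac_pos:
  assumes "a > 0"
  shows "diffeomorphic (N_ac a c) (sphere (0::complex) 1 \<times> (UNIV :: (real^2) set))"
proof -
  define f where "f = (\<lambda>z::complex^3. (z$1 * complex_of_real (inverse (cmod (z$1))),
    vector [Re (z$2), Im (z$2)] :: real^2))"
  define R where "R = (\<lambda>v::real^2. sqrt ((v$1)\<^sup>2 + (v$2)\<^sup>2 + 2 * a))"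
  define g where "g = (\<lambda>(e::complex, v::real^2). vector [e * complex_of_real (R v),
    Complex (v$1) (v$2), c + cnj (e * Complex (v$1) (v$2))] :: complex^3)"
  have R: "R v > 0" "(R v)\<^sup>2 = (v$1)\<^sup>2 + (v$2)\<^sup>2 + 2 * a" for v
    using assms by (auto simp: R_def intro!: add_nonneg_pos)
  have N: "(cmod (z$1))\<^sup>2 = (cmod (z$2))\<^sup>2 + 2 * a"
      "z$3 = c + cnj (z$1 * z$2) / complex_of_real (cmod (z$1))" "z$1 \<noteq> 0" if "z \<in> N_ac a c" for z
  proof -
    show *: "(cmod (z$1))\<^sup>2 = (cmod (z$2))\<^sup>2 + 2 * a"
      "z$3 = c + cnj (z$1 * z$2) / complex_of_real (cmod (z$1))"
      using that assms N_ac_iff by auto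
    have "(cmod (z$1))\<^sup>2 > 0" unfolding *(1) using assms by (intro add_nonneg_pos) auto
    then show "z$1 \<noteq> 0" by auto
  qed
  have "open {z::complex^3. z$1 \<noteq> 0}" by (intro open_Collect_neq continuous_intros)
  then have sf: "smooth_on {z. z$1 \<noteq> 0} f"
    unfolding f_def by (intro smooth_on_intros) auto
  have sg: "smooth_on UNIV g"
    using R(1) unfolding g_def R_def case_prod_beta
    by (intro smooth_on_intros) auto
  have "homeomorphism (N_ac a c) (sphere 0 1 \<times> UNIV) f g"
  proof (rule homeomorphismI)
    show "continuous_on (N_ac a c) f"
      by (rule continuous_on_subset[OF smooth_on_imp_continuous_on[OF sf]]) (use N(3) in auto)
    show "continuous_on (sphere 0 1 \<times> UNIV) g"
      by (rule continuous_on_subset[OF smooth_on_imp_continuous_on[OF sg]]) auto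
    show "f ` N_ac a c \<subseteq> sphere 0 1 \<times> UNIV"
      using N(3) by (auto simp: f_def norm_mult norm_inverse)
    show "g ` (sphere 0 1 \<times> UNIV) \<subseteq> N_ac a c"
    proof clarsimp
      fix e :: complex and v :: "real^2" assume e: "cmod e = 1"
      have "cmod (e * complex_of_real (R v)) = R v" using e R(1)[of v] by (simp add: norm_mult)
      then show "g (e, v) \<in> N_ac a c"
        using assms R[of v] by (simp add: N_ac_iff g_def cmod_power2)
    qed
    show "g (f z) = z" if "z \<in> N_ac a c" for z
    proof -
      have "R (snd (f z)) = sqrt ((cmod (z$2))\<^sup>2 + 2 * a)"
        by (simp add: R_def f_def flip: cmod_power2)
      also have "\<dots> = cmod (z$1)"
        by (simp flip: N(1)[OF that])
      finally show ?thesis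
        using N(2,3)[OF that] by (simp add: g_def f_def vec_eq_iff forall_3 case_prod_beta field_simps)
    qed
    show "f (g y) = y" if "y \<in> sphere 0 1 \<times> UNIV" for y
    proof -
      obtain e v where y: "y = (e, v)" "cmod e = 1" using \<open>y \<in> _\<close> by auto
      then have "cmod (e * complex_of_real (R v)) = R v" using R(1)[of v] by (simp add: norm_mult)
      then show ?thesis
        using R(1)[of v] y by (simp add: f_def g_def vec_eq_iff forall_2 field_simps)
    qed
  qed
  then show ?thesis
    unfolding diffeomorphic_def using smooth_on_imp_smooth_map_on[OF sf] smooth_on_imp_smooth_map_on[OF sg] N(3)
    by blast
qed

lemma diffeomorphic_N_ac:
  assumes "a \<noteq> 0"
  shows "diffeomorphic (N_ac a c) (sphere (0::complex) 1 \<times> (UNIV :: (real^2) set))"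
proof (cases "a > 0")
  case False
  then have "- a > 0" using assms by simp
  from diffeomorphic_swap12[OF diffeomorphic_N_ac_pos[OF this]] show ?thesis
    using N_ac_uminus[of "- a"] by simp
qed (simp add: diffeomorphic_N_ac_pos)

lemma nonsingular_SL3_N_ac:
  assumes "a \<noteq> 0"
  shows "nonsingular_SL3 (N_ac a c)"
proof -
  have pos: "SL_submanifold (N_ac a c)" if "a > 0" for a
  proof -
    have "N_ac a c \<inter> {z. z$1 \<noteq> 0} = N_ac a c"
      using that by (auto simp: N_ac_def add_nonneg_eq_0_iff)
    then show ?thesis using SL_submanifold_N_ac[of a c] that by simp
  qed
  have "SL_submanifold (N_ac a c)"
  proof (cases "a > 0")
    case False
    then have "- a > 0" using assms by simp
    from SL_submanifold_swap12[OF pos[OF this]] show ?thesis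
      using N_ac_uminus[of "- a"] by simp
  qed (rule pos)
  then show ?thesis by (simp add: nonsingular_SL3_def closed_N_ac)
qed

lemma nonsingular_SL3_imp_singular_SL3:
  assumes "nonsingular_SL3 S"
  shows "singular_SL3 S"
proof -
  have "singular_points S = {}"
    using assms by (auto simp: nonsingular_SL3_def singular_points_def intro!: exI[of _ UNIV])
  then show ?thesis using assms by (simp add: nonsingular_SL3_def singular_SL3_def)
qed

section \<open>The cone over the torus\<close>

lemma N_0_iff:
  "z \<in> N_ac 0 c \<longleftrightarrow> cmod (z$1) = cmod (z$2) \<and> z$3 = c + cnj (z$1 * z$2) / complex_of_real (cmod (z$1))"
  using N_ac_iff[of 0 z c] by (simp add: power2_eq_iff_nonneg)

text \<open>Relative to the vertex, both conditions in \<open>N_0_iff\<close> are homogeneous of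
  degree one under positive scaling.\<close>

lemma N_0_dilation:
  assumes "z \<in> N_ac 0 c" "t > 0"
  shows "vector [0, 0, c] + t *\<^sub>R (z - vector [0, 0, c]) \<in> N_ac 0 c"
proof -
  let ?w = "vector [0, 0, c] + t *\<^sub>R (z - vector [0, 0, c]) :: complex^3"
  have w: "?w $ 1 = complex_of_real t * z$1" "?w $ 2 = complex_of_real t * z$2"
      "?w $ 3 = c + complex_of_real t * (z$3 - c)"
    by (simp_all add: scaleR_conv_of_real[of _ "_ :: complex"])
  show ?thesis
    using assms unfolding N_0_iff w by (simp add: norm_mult)
qed

lemma diffeomorphic_N_0_link:
  "diffeomorphic (N_ac 0 c \<inter> sphere (vector [0, 0, c]) 1) torus2"
proof -
  \<comment> \<open>On the cone \<open>|z1| = |z2| = |z3 - c|\<close>, so on the unit sphere each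
    modulus is \<open>1 / sqrt 3\<close>; multiplication by \<open>s\<close> makes the first two
    coordinates unit.\<close>
  define s where "s = sqrt (3::real)"
  have s: "s > 0" "s * s = 3" by (auto simp: s_def)
  define f where "f = (\<lambda>z::complex^3. (complex_of_real s * z$1, complex_of_real s * z$2))"
  define g where "g = (\<lambda>e::complex \<times> complex. vector [complex_of_real (1/s) * fst e,
    complex_of_real (1/s) * snd e, c + complex_of_real (1/s) * cnj (fst e * snd e)] :: complex^3)"
  have sf: "smooth_on UNIV f" and sg: "smooth_on UNIV g"
    unfolding f_def g_def by (intro smooth_on_intros open_UNIV)+
  have norm_iff: "z \<in> sphere (vector [0, 0, c]) 1 \<longleftrightarrow> (cmod (z$1))\<^sup>2 + (cmod (z$2))\<^sup>2 + (cmod (z$3 - c))\<^sup>2 = 1" for z :: "complex^3"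
    by (simp add: dist_norm norm_vec_def L2_set_def sum_3 norm_minus_commute)
  have N: "s * cmod (z$1) = 1" "cmod (z$2) = cmod (z$1)" "z$3 = c + cnj (z$1 * z$2) / complex_of_real (cmod (z$1))"
    if "z \<in> N_ac 0 c \<inter> sphere (vector [0, 0, c]) 1" for z
  proof -
    show z: "cmod (z$2) = cmod (z$1)" "z$3 = c + cnj (z$1 * z$2) / complex_of_real (cmod (z$1))"
      using that by (auto simp: N_0_iff)
    have "cmod (z$3 - c) = cmod (z$1)" using z by (simp add: norm_mult norm_divide)
    then have "3 * (cmod (z$1))\<^sup>2 = 1"
      using that z(1) unfolding Int_iff norm_iff by simp
    then have "(s * cmod (z$1))\<^sup>2 = 1\<^sup>2" using s by (simp add: power_mult_distrib power2_eq_square[of s])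
    then show "s * cmod (z$1) = 1" using s by (subst (asm) power2_eq_iff_nonneg) auto
  qed
  have "homeomorphism (N_ac 0 c \<inter> sphere (vector [0, 0, c]) 1) torus2 f g"
  proof (rule homeomorphismI)
    show "continuous_on (N_ac 0 c \<inter> sphere (vector [0, 0, c]) 1) f" "continuous_on torus2 g"
      using continuous_on_subset smooth_on_imp_continuous_on sf sg by blast+
    show "f ` (N_ac 0 c \<inter> sphere (vector [0, 0, c]) 1) \<subseteq> torus2"
    proof (rule image_subsetI)
      fix z assume "z \<in> N_ac 0 c \<inter> sphere (vector [0, 0, c]) 1"
      from N[OF this] show "f z \<in> torus2" using s by (simp add: f_def torus2_def norm_mult)
    qed
    show "g ` torus2 \<subseteq> N_ac 0 c \<inter> sphere (vector [0, 0, c]) 1"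
    proof (rule image_subsetI)
      fix e assume "e \<in> torus2"
      then have e: "cmod (fst e) = 1" "cmod (snd e) = 1" by (auto simp: torus2_def)
      have n: "cmod (g e $ 1) = 1/s" "cmod (g e $ 2) = 1/s" "cmod (g e $ 3 - c) = 1/s"
        using e s(1) by (simp_all add: g_def norm_mult norm_divide)
      have "(1/s)\<^sup>2 + (1/s)\<^sup>2 + (1/s)\<^sup>2 = 1"
        using s by (simp add: power2_eq_square)
      moreover have "cnj (g e $ 1 * g e $ 2) / complex_of_real (1/s) = complex_of_real (1/s) * cnj (fst e * snd e)"
        using s(1) by (simp add: g_def field_simps)
      ultimately show "g e \<in> N_ac 0 c \<inter> sphere (vector [0, 0, c]) 1"
        unfolding Int_iff norm_iff N_0_iff n by (simp add: g_def)
    qed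
    show "g (f z) = z" if "z \<in> N_ac 0 c \<inter> sphere (vector [0, 0, c]) 1" for z
    proof -
      have "cmod (z$1) = 1/s" using N(1)[OF that] s by (simp add: field_simps)
      then have "z$3 = c + complex_of_real s * cnj (z$1 * z$2)"
        using N(3)[OF that] by simp
      then show ?thesis
        using s(1) by (simp add: g_def f_def vec_eq_iff forall_3)
    qed
    show "f (g e) = e" if "e \<in> torus2" for e
      using s by (simp add: f_def g_def)
  qed
  then show ?thesis
    unfolding diffeomorphic_def using smooth_on_imp_smooth_map_on[OF sf] smooth_on_imp_smooth_map_on[OF sg] by blast
qed

section \<open>Singularity of the vertex\<close>

text \<open>Continuity of \<open>\<psi>\<close> pulls the ray back to parameters tending to
  \<open>\<psi> p\<close>. Injectivity of \<open>T\<close> makes their displacement \<open>x\<close>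
  of order \<open>t\<close>, so \<open>T ((1/t) *\<^sub>R x)\<close> approximates \<open>v\<close>,
  and the finite-dimensional subspace \<open>range T\<close> is closed.\<close>

lemma immersion_ray_tangent:
  fixes \<phi> :: "'a::euclidean_space \<Rightarrow> 'b::euclidean_space"
  assumes "homeomorphism V M \<phi> \<psi>" "p \<in> M" "(\<phi> has_derivative T) (at (\<psi> p))" "inj T"
    and ray: "\<forall>\<^sub>F t in at_right 0. p + t *\<^sub>R v \<in> M"
  shows "v \<in> range T"
proof -
  have T: "linear T" using assms(3) by (rule has_derivative_linear)
  obtain B where B: "B > 0" "\<And>x. norm (T x) \<ge> B * norm x"
    using linear_inj_bounded_below_pos[OF T assms(4)] by (metis mult.commute)
  have "v \<in> closure (range T)"
    unfolding closure_approachable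
  proof (intro allI impI)
    fix e :: real assume "e > 0"
    \<comment> \<open>The bound \<open>B/2\<close> lets the linearisation error be absorbed into
      \<open>B * norm x\<close>, giving \<open>norm x \<le> 2 * t * norm v / B\<close>; the second
      bound then keeps the error below \<open>t * e\<close>. The \<open>+ 1\<close> keeps the
      denominator positive when \<open>v = 0\<close>.\<close>
    define d where "d = min (B/2) (e * B / (4 * (norm v + 1)))"
    have d: "d > 0" "d \<le> B/2" "d \<le> e * B / (4 * (norm v + 1))"
      unfolding d_def using B(1) \<open>e > 0\<close>
      by (simp_all only: min.cobounded1 min.cobounded2) (auto intro!: divide_pos_pos add_nonneg_pos)
    obtain r where r: "r > 0" "\<And>y. norm (y - \<psi> p) < r \<Longrightarrow> norm (\<phi> y - \<phi> (\<psi> p) - T (y - \<psi> p)) \<le> d * norm (y - \<psi> p)"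
      using assms(3) d(1) unfolding has_derivative_at_alt by blast
    have "((\<lambda>t. p + t *\<^sub>R v) \<longlongrightarrow> p) (at_right 0)"
      by (auto intro!: tendsto_eq_intros)
    moreover have "continuous_on M \<psi>" using assms(1) by (simp add: homeomorphism_def)
    ultimately have "((\<lambda>t. \<psi> (p + t *\<^sub>R v)) \<longlongrightarrow> \<psi> p) (at_right 0)"
      using continuous_on_tendsto_compose assms(2) ray by blast
    then have "\<forall>\<^sub>F t in at_right 0. dist (\<psi> (p + t *\<^sub>R v)) (\<psi> p) < r"
      using r(1) tendstoD by blast
    with ray have "\<forall>\<^sub>F t in at_right 0. p + t *\<^sub>R v \<in> M \<and> dist (\<psi> (p + t *\<^sub>R v)) (\<psi> p) < r \<and> t > 0"
      by (intro eventually_conj eventually_at_right_less)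
    then obtain t where t: "p + t *\<^sub>R v \<in> M" "dist (\<psi> (p + t *\<^sub>R v)) (\<psi> p) < r" "t > 0"
      using eventually_happens trivial_limit_at_right_real by blast
    define x where "x = \<psi> (p + t *\<^sub>R v) - \<psi> p"
    have inv: "\<phi> (\<psi> q) = q" if "q \<in> M" for q
      using assms(1) that by (simp add: homeomorphism_def)
    have le: "norm (t *\<^sub>R v - T x) \<le> d * norm x"
      using r(2)[of "\<psi> (p + t *\<^sub>R v)"] t(2) inv[OF t(1)] inv[OF assms(2)] by (simp add: x_def dist_norm)
    have "B * norm x \<le> norm (T x)" by (rule B(2))
    also have "\<dots> \<le> norm (t *\<^sub>R v) + norm (t *\<^sub>R v - T x)"
      by (metis norm_minus_commute norm_triangle_sub)
    also have "\<dots> \<le> t * norm v + B/2 * norm x"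
      using le t(3) mult_right_mono[OF d(2) norm_ge_zero[of x]] by simp
    finally have "norm x \<le> 2 * t * norm v / B"
      using B(1) by (simp add: field_simps)
    then have "d * norm x \<le> e * B / (4 * (norm v + 1)) * (2 * t * norm v / B)"
      by (intro mult_mono d(3)) (use B(1) \<open>e > 0\<close> in auto)
    also have "\<dots> = t * (e / 2 * (norm v / (norm v + 1)))"
    proof -
      have "e * B / (4 * n) * (2 * t * norm v / B) = t * (e / 2 * (norm v / n))" if "n > 0" for n
        using that B(1) by (simp add: field_simps)
      then show ?thesis using add_nonneg_pos[OF norm_ge_zero zero_less_one] by blast
    qed
    also have "\<dots> < t * e"
    proof -
      have "norm v / (norm v + 1) \<le> 1"
        by (rule divide_le_eq_1_pos[THEN iffD2]) (auto simp: add_nonneg_pos)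
      then have "e / 2 * (norm v / (norm v + 1)) \<le> e / 2 * 1"
        using \<open>e > 0\<close> by (intro mult_left_mono) auto
      also have "\<dots> < e" using \<open>e > 0\<close> by simp
      finally show ?thesis using t(3) by (rule mult_strict_left_mono)
    qed
    finally have "norm (t *\<^sub>R v - T x) < t * e" using le by simp
    moreover have "t *\<^sub>R v - T x = t *\<^sub>R (v - T ((1/t) *\<^sub>R x))"
      using t(3) by (simp add: linear_scale[OF T] algebra_simps)
    ultimately have "dist (T ((1/t) *\<^sub>R x)) v < e"
      using t(3) by (simp add: dist_norm norm_minus_commute)
    then show "\<exists>y\<in>range T. dist y v < e" by blast
  qed
  moreover have "closed (range T)"
    by (intro closed_subspace linear_subspace_image[OF T] subspace_UNIV)
  ultimately show ?thesis by simp
qed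

lemma N_0_vertex_singular:
  assumes "open U" "vector [0, 0, c] \<in> U"
  shows "\<not> SL_submanifold (N_ac 0 c \<inter> U)"
proof
  let ?p = "vector [0, 0, c] :: complex^3"
  assume "SL_submanifold (N_ac 0 c \<inter> U)"
  moreover have "?p \<in> N_ac 0 c \<inter> U" using assms(2) by (simp add: N_0_iff)
  ultimately obtain U' V \<phi> \<psi> where ch: "open U'" "?p \<in> U'"
      "smooth_on V \<phi>" "homeomorphism (V :: (real^3) set) (N_ac 0 c \<inter> U \<inter> U') \<phi> \<psi>"
      "\<forall>x\<in>V. inj (frechet_derivative \<phi> (at x)) \<and>
           (\<forall>a b. omega_C3 (frechet_derivative \<phi> (at x) a) (frechet_derivative \<phi> (at x) b) = 0)"
    unfolding SL_submanifold_def by meson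
  let ?M = "N_ac 0 c \<inter> U \<inter> U'"
  have p: "?p \<in> ?M" using \<open>?p \<in> N_ac 0 c \<inter> U\<close> ch(2) by simp
  then have "\<psi> ?p \<in> V" using ch(4) by (auto simp: homeomorphism_def)
  define T where "T = frechet_derivative \<phi> (at (\<psi> ?p))"
  have T: "(\<phi> has_derivative T) (at (\<psi> ?p))"
    using smooth_on_imp_differentiable_at[OF ch(3) \<open>\<psi> ?p \<in> V\<close>] by (simp add: T_def frechet_derivative_works)
  have Lag: "inj T" "\<And>a b. omega_C3 (T a) (T b) = 0"
    using ch(5) \<open>\<psi> ?p \<in> V\<close> by (auto simp: T_def)
  \<comment> \<open>Dilation keeps the whole open ray through \<open>?p + v\<close> in the cone, and
    its points near the vertex lie in the open sets \<open>U\<close> and \<open>U'\<close>.\<close>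
  have tangent: "v \<in> range T" if "?p + v \<in> N_ac 0 c" for v
  proof (rule immersion_ray_tangent[OF ch(4) p T Lag(1)])
    have "((\<lambda>t. ?p + t *\<^sub>R v) \<longlongrightarrow> ?p) (at_right 0)"
      by (auto intro!: tendsto_eq_intros)
    then have "\<forall>\<^sub>F t in at_right 0. ?p + t *\<^sub>R v \<in> U \<inter> U'"
      using assms ch(1,2) by (intro topological_tendstoD) auto
    moreover have "\<forall>\<^sub>F t in at_right 0. (t::real) > 0" by (rule eventually_at_right_less)
    ultimately show "\<forall>\<^sub>F t in at_right 0. ?p + t *\<^sub>R v \<in> ?M"
      by eventually_elim (use N_0_dilation[OF that] in auto)
  qed
  \<comment> \<open>Both lie on the cone directions since \<open>cnj (1 * 1) = 1\<close> and
    \<open>cnj (\<i> * \<i>) = -1\<close>; the form pairs them to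
    \<open>1 + 1 + 0 = 2\<close>.\<close>
  have "vector [1, 1, 1] \<in> range T" "vector [\<i>, \<i>, -1] \<in> range T"
    by (rule tangent; simp add: N_0_iff)+
  then have "omega_C3 (vector [1, 1, 1]) (vector [\<i>, \<i>, -1]) = 0"
    using Lag(2) by (metis rangeE)
  then show False by (simp add: omega_C3_def sum_3)
qed

lemma singular_points_N_0: "singular_points (N_ac 0 c) = {vector [0, 0, c]}"
  and SL_submanifold_N_0: "SL_submanifold (N_ac 0 c - {vector [0, 0, c]})"
proof -
  let ?p = "vector [0, 0, c] :: complex^3"
  \<comment> \<open>On the cone \<open>z1 = 0\<close> forces \<open>z2 = 0\<close>, and then
    \<open>z3 = c\<close> by \<open>0/0 = 0\<close>, so the chart domain omits only the
    vertex.\<close>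
  have eq: "N_ac 0 c \<inter> {z. z$1 \<noteq> 0} = N_ac 0 c - {?p}"
    by (auto simp: N_0_iff vec_eq_iff forall_3)
  then show SL: "SL_submanifold (N_ac 0 c - {?p})"
    using SL_submanifold_N_ac[of 0 c] by simp
  show "singular_points (N_ac 0 c) = {?p}"
  proof
    show "singular_points (N_ac 0 c) \<subseteq> {?p}"
      using SL by (auto simp: singular_points_def Diff_eq dest: spec[of _ "- {?p}"])
    show "{?p} \<subseteq> singular_points (N_ac 0 c)"
      using N_0_vertex_singular by (auto simp: singular_points_def N_0_iff)
  qed
qed

section \<open>Assembly of the cone and fibration statements\<close>

lemma SL_T2_cone_N_0: "SL_T2_cone (vector [0, 0, c]) (N_ac 0 c)"
  unfolding SL_T2_cone_def singular_SL3_def singular_points_N_0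
  using closed_N_ac SL_submanifold_N_0 N_0_dilation diffeomorphic_N_0_link by blast

lemma SL_fibration_F_fib: "SL_fibration UNIV F_fib UNIV"
proof -
  have "singular_SL3 (N_ac a c)" for a c
    using nonsingular_SL3_imp_singular_SL3[OF nonsingular_SL3_N_ac] SL_T2_cone_N_0
    by (cases "a = 0") (auto simp: SL_T2_cone_def)
  then show ?thesis
    by (auto simp: SL_fibration_def continuous_F_fib surj_F_fib F_fib_eq_iff)
qed

theorem theorem5p1:
  shows "(\<forall>a c. a \<noteq> 0 \<longrightarrow>
            nonsingular_SL3 (N_ac a c) \<and>
            diffeomorphic (N_ac a c) (sphere (0::complex) 1 \<times> (UNIV :: (real^2) set)))
       \<and> (\<forall>c. SL_T2_cone (vector [0, 0, c]) (N_ac 0 c) \<and>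
               singular_points (N_ac 0 c) = {vector [0, 0, c]})
       \<and> (\<forall>z::complex^3. let a = ((cmod (z$1))\<^sup>2 - (cmod (z$2))\<^sup>2) / 2 in
              length (filter id [a = 0 \<and> z$1 = 0 \<and> z$2 = 0, a \<ge> 0 \<and> z$1 \<noteq> 0, a < 0]) = 1)
       \<and> (\<forall>a c. F_fib -` {(a, c)} = N_ac a c)
       \<and> SL_fibration UNIV F_fib UNIV
       \<and> (\<exists>g1 g2 :: complex^3 \<Rightarrow> real \<times> complex.
            smooth_on {z. z$1 \<noteq> 0} g1 \<and> smooth_on {z. z$2 \<noteq> 0} g2 \<and>
            (\<forall>z. cmod (z$1) \<ge> cmod (z$2) \<and> z$1 \<noteq> 0 \<longrightarrow> F_fib z = g1 z) \<and>
            (\<forall>z. cmod (z$1) \<le> cmod (z$2) \<and> z$2 \<noteq> 0 \<longrightarrow> F_fib z = g2 z))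
       \<and> (\<forall>z. cmod (z$1) = cmod (z$2) \<longrightarrow> \<not> smooth_at F_fib z)"
proof (intro conjI)
  have sq: "(cmod x)\<^sup>2 < (cmod y)\<^sup>2 \<longleftrightarrow> cmod x < cmod y" for x y
    by (metis abs_le_square_iff abs_norm_cancel not_le)
  show "\<forall>a c. a \<noteq> 0 \<longrightarrow> nonsingular_SL3 (N_ac a c) \<and>
      diffeomorphic (N_ac a c) (sphere (0::complex) 1 \<times> (UNIV :: (real^2) set))"
    using nonsingular_SL3_N_ac diffeomorphic_N_ac by blast
  show "\<forall>c. SL_T2_cone (vector [0, 0, c]) (N_ac 0 c) \<and>
      singular_points (N_ac 0 c) = {vector [0, 0, c]}"
    using SL_T2_cone_N_0 singular_points_N_0 by blast
  \<comment> \<open>Exactly one case applies: if \<open>a \<ge> 0\<close> and \<open>z1 = 0\<close>,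
    then \<open>|z2| \<le> |z1|\<close> gives \<open>z2 = 0\<close> and \<open>a = 0\<close>; if
    \<open>a < 0\<close>, both other cases fail by the sign of \<open>a\<close>.\<close>
  show "\<forall>z::complex^3. let a = ((cmod (z$1))\<^sup>2 - (cmod (z$2))\<^sup>2) / 2 in
      length (filter id [a = 0 \<and> z$1 = 0 \<and> z$2 = 0, a \<ge> 0 \<and> z$1 \<noteq> 0, a < 0]) = 1"
    by (auto simp: Let_def not_le sq)
qed (rule F_fib_piecewise_smooth | simp add: vimage_F_fib SL_fibration_F_fib F_fib_not_smooth_at)+

end
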